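(* Let $\mathcal{T}=\mathcal{S}\times_1\mathbf{\Pi}_1\times_2\mathbf{\Pi}_2\times_3\mathbf{\Pi}_3\in\mathbb{R}^{p_1\times p_2\times p_3}$ be a tensor mixed-membership blockmodel, where $\mathcal{S}\in\mathbb{R}^{r_1\times r_2\times r_3}$ and each $\mathbf{\Pi}_k\in[0,1]^{p_k\times r_k}$ is a membership matrix. Let $\mathcal{T}=\mathcal{C}\times_1\mathbf{U}_1\times_2\mathbf{U}_2\times_3\mathbf{U}_3$ denote its Tucker decomposition and let $\lambda=\lambda_{\min}(\mathcal{C})$ denote the smallest singular value of $\mathcal{C}$. Suppose that $r_k\le r_{-k}$ for each $k$ and that: (Regularity and identifiability) for each $k$, $\frac{p_k}{r_k}\lesssim\lambda_{\min}(\mathbf{\Pi}_k^\top\mathbf{\Pi}_k)\le\lambda_{\max}(\mathbf{\Pi}_k^\top\mathbf{\Pi}_k)\lesssim\frac{p_k}{r_k}$; each matricization $\mathcal{M}_k(\mathcal{S})$ has rank $r_k$; and there is at least one pure node for each community for every mode; (Signal strength) the quantity $\Delta=\lambda_{\min}(\mathcal{S})$ satisfies $$\frac{\Delta^2}{\sigma^2}\gtrsim\frac{\kappa^2p_{\max}^2\log(p_{\max})\,r_1r_2r_3}{p_1p_2p_3\,p_{\min}^{1/2}}.$$ Then $$\lambda\asymp\Delta\frac{(p_1p_2p_3)^{1/2}}{(r_1r_2r_3)^{1/2}},\qquad \mu_0=O(1),$$ where $\mu_0$ is the incoherence parameter of $\mathcal{T}$. Furthermore, $\mathbf{U}_k^{(\mathrm{pure})}(\mathbf{U}_k^{(\mathrm{pure})})^\top=(\mathbf{\Pi}_k^\top\mathbf{\Pi}_k)^{-1}$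 for each $k$.
   Context: Asymptotic notation: $f\lesssim g$ means that there is a uniform constant $C>0$ with $f\le Cg$; $f\asymp g$ means $f\lesssim g$ and $g\lesssim f$; $f=O(g)$ means $f\lesssim g$. A membership matrix is a matrix in $[0,1]^{p_k\times r_k}$ each of whose rows sums to one; its columns are the communities. An index $i$ is a pure node along mode $k$ for community $l$ if $(\mathbf{\Pi}_k)_{i\cdot}$ is the $l$-th standard basis vector. $\mathbf{U}_k^{(\mathrm{pure})}\in\mathbb{R}^{r_k\times r_k}$ is the matrix whose $l$-th row is the row of $\mathbf{U}_k$ indexed by a pure node of community $l$ along mode $k$. $\mathcal{M}_k$ is mode-$k$ matricization, $\times_k$ the mode-$k$ product, $r_{-k}=\prod_{j\ne k}r_j$, $p_{\max}=\max_kp_k$, $p_{\min}=\min_kp_k$. In the Tucker decomposition, $\mathbf{U}_k\in\mathbb{R}^{p_k\times r_k}$ has orthonormal columns, the leading $r_k$ left singular vectors of $\mathcal{M}_k(\mathcal{T})$, and $\mathcal{C}\in\mathbb{R}^{r_1\times r_2\times r_3}$. For a matrix $\mathbf{M}$, $\lambda_{\min}(\mathbf{M})$ is its smallest nonzero singular value (eigenvalue if $\mathbf{M}$ is square), and for a tensor $\lambda_{\min}(\mathcal{T})=\min_k\lambda_{\min}(\mathcal{M}_k(\mathcal{T}))$ with the smallest nonzero singular value of each matricization. $\kappa=\max_k\|\mathcal{M}_k(\mathcal{S})\|/\lambda_{\min}(\mathcal{M}_k(\mathcal{S}))$ is the condition number of $\mathcal{S}$, and $\sigma>0$ is the noise level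 (an upper bound for the subgaussian $\psi_2$-norms of the entries of the noise tensor in the observation model $\widehat{\mathcal{T}}=\mathcal{T}+\mathcal{Z}$). $\|\mathbf{M}\|_{2,\infty}=\max_i\|e_i^\top\mathbf{M}\|$ is the maximum row Euclidean norm. The incoherence parameter $\mu_0$ is the smallest number with $\max_k\sqrt{p_k/r_k}\,\|\mathbf{U}_k\|_{2,\infty}\le\mu_0$. *)

theory Defs
  imports
    Complex_Main
    "HOL-Library.Numeral_Type"
    "Jordan_Normal_Form.Char_Poly"
    "Jordan_Normal_Form.Gauss_Jordan_Elimination"
    "Jordan_Normal_Form.DL_Rank"
begin

text \<open>
  Dimensions have to vary inside a statement with uniform constants, so matrices are those of
  Jordan_Normal_Form and an order-three tensor is a real function on multi-indices, of which only
  the values on the index set of its dimensions matter.  The modes are the elements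
  1, 2, 3 of the three-element type \<open>3\<close>, in which \<open>3 = 0\<close> and addition is cyclic.
\<close>

type_synonym dims = "3 \<Rightarrow> nat"
type_synonym tensor = "(3 \<Rightarrow> nat) \<Rightarrow> real"

definition index_set :: "dims \<Rightarrow> (3 \<Rightarrow> nat) set" where
  "index_set d = {i. \<forall>k. i k < d k}"

definition tensor_eq :: "dims \<Rightarrow> tensor \<Rightarrow> tensor \<Rightarrow> bool" where
  "tensor_eq d X Y \<longleftrightarrow> (\<forall>i\<in>index_set d. X i = Y i)"

definition mode_prod :: "3 \<Rightarrow> tensor \<Rightarrow> real mat \<Rightarrow> tensor" where
  "mode_prod k X A = (\<lambda>i. \<Sum>j<dim_col A. A $$ (i k, j) * X (i(k := j)))"

definition multilinear_prod :: "tensor \<Rightarrow> (3 \<Rightarrow> real mat) \<Rightarrow> tensor" where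
  "multilinear_prod X A = mode_prod 3 (mode_prod 2 (mode_prod 1 X (A 1)) (A 2)) (A 3)"

text \<open>
  The modes other than \<open>k\<close> are \<open>k + 1\<close> and \<open>k + 2\<close>; the columns are enumerated with the index of
  mode \<open>k + 1\<close> running fastest.
\<close>

definition matricize :: "dims \<Rightarrow> 3 \<Rightarrow> tensor \<Rightarrow> real mat" where
  "matricize d k X = mat (d k) (d (k + 1) * d (k + 2))
     (\<lambda>(a, b). X ((\<lambda>_. 0)(k := a, k + 1 := b mod d (k + 1), k + 2 := b div d (k + 1))))"

definition euclid_norm :: "real vec \<Rightarrow> real" where
  "euclid_norm v = sqrt (v \<bullet> v)"

definition spectral_norm :: "real mat \<Rightarrow> real" where
  "spectral_norm M =
     Sup {euclid_norm (M *\<^sub>v v) | v. v \<in> carrier_vec (dim_col M) \<and> euclid_norm v = 1}"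

definition two_inf_norm :: "real mat \<Rightarrow> real" where
  "two_inf_norm M = Max ((\<lambda>i. euclid_norm (row M i)) ` {..<dim_row M})"

text \<open>
  For a wide matrix the following set may contain \<open>0\<close> in addition to the usual singular values;
  only its nonzero elements are used.
\<close>

definition singular_values :: "real mat \<Rightarrow> real set" where
  "singular_values M = {s. 0 \<le> s \<and> eigenvalue (M\<^sup>T * M) (s\<^sup>2)}"

definition min_singval :: "real mat \<Rightarrow> real" where
  "min_singval M = Min (singular_values M - {0})"

definition lambda_min :: "real mat \<Rightarrow> real" where
  "lambda_min A = Min ({e. eigenvalue A e} - {0})"

definition lambda_max :: "real mat \<Rightarrow> real" where
  "lambda_max A = Max {e. eigenvalue A e}"

definition lambda_min_tensor :: "dims \<Rightarrow> tensor \<Rightarrow> real" where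
  "lambda_min_tensor d X = (MIN k. min_singval (matricize d k X))"

definition condition_number :: "dims \<Rightarrow> tensor \<Rightarrow> real" where
  "condition_number d X =
     (MAX k. spectral_norm (matricize d k X) / min_singval (matricize d k X))"

definition is_svd :: "real mat \<Rightarrow> real mat \<Rightarrow> (nat \<Rightarrow> real) \<Rightarrow> real mat \<Rightarrow> bool" where
  "is_svd M W s V \<longleftrightarrow>
     (let m = dim_row M; n = dim_col M in
      W \<in> carrier_mat m m \<and> W\<^sup>T * W = 1\<^sub>m m \<and>
      V \<in> carrier_mat n n \<and> V\<^sup>T * V = 1\<^sub>m n \<and>
      (\<forall>i < min m n. 0 \<le> s i) \<and>
      (\<forall>i j. i \<le> j \<and> j < min m n \<longrightarrow> s j \<le> s i) \<and>
      M = W * mat m n (\<lambda>(i, j). if i = j then s i else 0) * V\<^sup>T)"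

definition leading_left_singular_vectors :: "real mat \<Rightarrow> nat \<Rightarrow> real mat \<Rightarrow> bool" where
  "leading_left_singular_vectors M r U \<longleftrightarrow> r \<le> dim_row M \<and>
     (\<exists>W s V. is_svd M W s V \<and> U = mat_of_cols (dim_row M) (map (col W) [0..<r]))"

definition tucker_decomposition ::
    "dims \<Rightarrow> dims \<Rightarrow> tensor \<Rightarrow> tensor \<Rightarrow> (3 \<Rightarrow> real mat) \<Rightarrow> bool" where
  "tucker_decomposition p r X C U \<longleftrightarrow>
     (\<forall>k. leading_left_singular_vectors (matricize p k X) (r k) (U k)) \<and>
     tensor_eq p X (multilinear_prod C U)"

definition membership_matrix :: "nat \<Rightarrow> nat \<Rightarrow> real mat \<Rightarrow> bool" where
  "membership_matrix p r P \<longleftrightarrow> P \<in> carrier_mat p r \<and>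
     (\<forall>i<p. \<forall>l<r. P $$ (i, l) \<in> {0..1}) \<and> (\<forall>i<p. (\<Sum>l<r. P $$ (i, l)) = 1)"

definition pure_node :: "real mat \<Rightarrow> nat \<Rightarrow> nat \<Rightarrow> bool" where
  "pure_node P l i \<longleftrightarrow> i < dim_row P \<and> row P i = unit_vec (dim_col P) l"

text \<open>A choice of one pure node \<open>n l\<close> for every community \<open>l\<close>.\<close>

definition pure_choice :: "real mat \<Rightarrow> (nat \<Rightarrow> nat) \<Rightarrow> bool" where
  "pure_choice P n \<longleftrightarrow> (\<forall>l < dim_col P. pure_node P l (n l))"

definition U_pure :: "real mat \<Rightarrow> (nat \<Rightarrow> nat) \<Rightarrow> real mat" where
  "U_pure U n = mat (dim_col U) (dim_col U) (\<lambda>(l, j). U $$ (n l, j))"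

definition incoherence :: "dims \<Rightarrow> dims \<Rightarrow> (3 \<Rightarrow> real mat) \<Rightarrow> real" where
  "incoherence p r U =
     (LEAST \<mu>::real. (MAX k. sqrt (real (p k) / real (r k)) * two_inf_norm (U k)) \<le> \<mu>)"

end

theory Submission
  imports Defs
begin

text \<open>
  The pure nodes make each \<open>P k\<close> injective, and the rank condition makes every matricization of
  \<open>S\<close> surjective; hence \<open>P k\<close> and the leading left singular vectors \<open>U k\<close> span the same space and
  \<open>U k = P k * B\<close> for a square matrix \<open>B\<close>.  Reading this identity at pure nodes shows that \<open>B\<close> is
  \<open>U_pure (U k)\<close>, and orthonormality of \<open>U k\<close> becomes \<open>B\<^sup>T * (P k)\<^sup>T * P k * B = 1\<close>, that is,
  \<open>B * B\<^sup>T\<close> inverts the Gram matrix.  The rows of \<open>U k\<close> are then the rows of \<open>P k\<close>, of norm at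
  most one, multiplied by \<open>B\<close>, which gives the incoherence bound.  Finally \<open>C\<close> and \<open>S\<close> give the same
  tensor \<open>T\<close> after multiplication by isometries and by the \<open>P k\<close>, respectively; each \<open>P k\<close> scales squared
  norms by a factor of order \<open>p k / r k\<close>, so the smallest singular values of corresponding
  matricizations differ by a factor of order \<open>sqrt (p\<^sub>1 p\<^sub>2 p\<^sub>3 / r\<^sub>1 r\<^sub>2 r\<^sub>3)\<close>.
\<close>

subsection \<open>Rayleigh quotients of symmetric matrices\<close>

lemma scalar_prod_self_nonneg: "0 \<le> (v :: real vec) \<bullet> v"
  by (simp add: scalar_prod_def sum_nonneg)

lemma scalar_prod_self_eq_0_iff:
  assumes "(v :: real vec) \<in> carrier_vec n"
  shows "v \<bullet> v = 0 \<longleftrightarrow> v = 0\<^sub>v n"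
proof
  assume "v \<bullet> v = 0"
  then have "\<forall>i\<in>{0..<dim_vec v}. v $ i * v $ i = 0"
    unfolding scalar_prod_def by (subst (asm) sum_nonneg_eq_0_iff) auto
  with assms show "v = 0\<^sub>v n" by (intro eq_vecI) auto
qed (use assms in auto)

lemma scalar_prod_self_pos:
  assumes "(v :: real vec) \<in> carrier_vec n" "v \<noteq> 0\<^sub>v n"
  shows "0 < v \<bullet> v"
  using scalar_prod_self_nonneg[of v] scalar_prod_self_eq_0_iff[OF assms(1)] assms(2) by simp

lemma quadratic_nonneg_discriminant:
  fixes a b c :: real
  assumes "\<And>t. 0 \<le> a + 2 * b * t + c * t\<^sup>2" "0 \<le> c"
  shows "b\<^sup>2 \<le> a * c"
proof (cases "c = 0")
  case True
  have "b = 0"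
  proof (rule ccontr)
    assume "b \<noteq> 0"
    \<comment> \<open>This \<open>t\<close> solves \<open>a + 2 * b * t = -1\<close>: a nonconstant
      affine function cannot stay nonnegative.\<close>
    with assms(1)[of "- (a + 1) / (2 * b)"] True show False by (simp add: field_simps)
  qed
  with True show ?thesis by simp
next
  case False
  with assms(1)[of "- b / c"] assms(2) show ?thesis
    by (simp add: field_simps power2_eq_square)
qed

lemma transpose_mult_vec_scalar:
  fixes A :: "real mat"
  assumes "A \<in> carrier_mat m n" "x \<in> carrier_vec n" "y \<in> carrier_vec m"
  shows "(A *\<^sub>v x) \<bullet> y = x \<bullet> (A\<^sup>T *\<^sub>v y)"
  using transpose_vec_mult_scalar[OF assms]
    comm_scalar_prod[of "A *\<^sub>v x" m y] comm_scalar_prod[of "A\<^sup>T *\<^sub>v y" n x] assms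
  by auto

text \<open>The form of \<open>H\<close> along the line \<open>x + t y\<close> is a nonnegative
  quadratic in \<open>t\<close>, so the discriminant bound applies. Semidefiniteness suffices, which
  is what the shifted matrices \<open>G - c\<close> below provide.\<close>

lemma psd_Cauchy_Schwarz:
  fixes H :: "real mat"
  assumes H: "H \<in> carrier_mat n n" and sym: "H\<^sup>T = H"
    and psd: "\<And>x. x \<in> carrier_vec n \<Longrightarrow> 0 \<le> x \<bullet> (H *\<^sub>v x)"
    and x: "x \<in> carrier_vec n" and y: "y \<in> carrier_vec n"
  shows "(x \<bullet> (H *\<^sub>v y))\<^sup>2 \<le> (x \<bullet> (H *\<^sub>v x)) * (y \<bullet> (H *\<^sub>v y))"
proof (rule quadratic_nonneg_discriminant)
  fix t :: real
  have Hx: "H *\<^sub>v x \<in> carrier_vec n" and Hy: "H *\<^sub>v y \<in> carrier_vec n" using H x y by auto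
  have "y \<bullet> (H *\<^sub>v x) = x \<bullet> (H *\<^sub>v y)"
    using transpose_mult_vec_scalar[OF H y x] sym comm_scalar_prod[OF Hy x] by simp
  moreover have "H *\<^sub>v (x + t \<cdot>\<^sub>v y) = H *\<^sub>v x + t \<cdot>\<^sub>v (H *\<^sub>v y)"
    using H x y by (simp add: mult_add_distrib_mat_vec[of _ n n] mult_mat_vec[of _ n n])
  ultimately have "(x + t \<cdot>\<^sub>v y) \<bullet> (H *\<^sub>v (x + t \<cdot>\<^sub>v y)) =
      x \<bullet> (H *\<^sub>v x) + 2 * (x \<bullet> (H *\<^sub>v y)) * t + (y \<bullet> (H *\<^sub>v y)) * t\<^sup>2"
    using x y Hx Hy
    by (simp add: add_scalar_prod_distrib[of _ n] scalar_prod_add_distrib[of _ n]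
        power2_eq_square algebra_simps)
  then show "0 \<le> x \<bullet> (H *\<^sub>v x) + 2 * (x \<bullet> (H *\<^sub>v y)) * t + (y \<bullet> (H *\<^sub>v y)) * t\<^sup>2"
    using psd[of "x + t \<cdot>\<^sub>v y"] x y by simp
qed (use psd y in auto)

lemma vec_Cauchy_Schwarz:
  assumes "(x :: real vec) \<in> carrier_vec n" "y \<in> carrier_vec n"
  shows "(x \<bullet> y)\<^sup>2 \<le> (x \<bullet> x) * (y \<bullet> y)"
  using psd_Cauchy_Schwarz[of "1\<^sub>m n" n x y] assms by (simp add: scalar_prod_self_nonneg)

lemma mult_mat_vec_bounded:
  fixes A :: "real mat"
  assumes A: "A \<in> carrier_mat m n"
  shows "\<exists>K>0. \<forall>x\<in>carrier_vec n. (A *\<^sub>v x) \<bullet> (A *\<^sub>v x) \<le> K * (x \<bullet> x)"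
\<comment> \<open>The squared Frobenius norm, plus one so that the constant stays positive when
  \<open>A\<close> is zero.\<close>
proof (intro exI[of _ "(\<Sum>i<m. row A i \<bullet> row A i) + 1"] conjI ballI)
  fix x :: "real vec" assume x: "x \<in> carrier_vec n"
  have "(A *\<^sub>v x) \<bullet> (A *\<^sub>v x) = (\<Sum>i<m. (row A i \<bullet> x)\<^sup>2)"
    using A by (simp add: scalar_prod_def[of "A *\<^sub>v x"] power2_eq_square atLeast0LessThan)
  also have "\<dots> \<le> (\<Sum>i<m. (row A i \<bullet> row A i) * (x \<bullet> x))"
    using A x by (intro sum_mono vec_Cauchy_Schwarz[of _ n]) auto
  also have "\<dots> \<le> ((\<Sum>i<m. row A i \<bullet> row A i) + 1) * (x \<bullet> x)"
    by (simp add: sum_distrib_right distrib_right scalar_prod_self_nonneg)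
  finally show "(A *\<^sub>v x) \<bullet> (A *\<^sub>v x) \<le> ((\<Sum>i<m. row A i \<bullet> row A i) + 1) * (x \<bullet> x)" .
qed (simp add: add_nonneg_pos sum_nonneg scalar_prod_self_nonneg)

lemma quadratic_form_bounded:
  fixes A :: "real mat"
  assumes A: "A \<in> carrier_mat n n"
  shows "\<exists>K>0. \<forall>x\<in>carrier_vec n. \<bar>x \<bullet> (A *\<^sub>v x)\<bar> \<le> K * (x \<bullet> x)"
proof -
  obtain K where K: "K > 0" "\<And>x. x \<in> carrier_vec n \<Longrightarrow> (A *\<^sub>v x) \<bullet> (A *\<^sub>v x) \<le> K * (x \<bullet> x)"
    using mult_mat_vec_bounded[OF A] by blast
  have "\<bar>x \<bullet> (A *\<^sub>v x)\<bar> \<le> sqrt K * (x \<bullet> x)" if x: "x \<in> carrier_vec n" for x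
  proof -
    have "(x \<bullet> (A *\<^sub>v x))\<^sup>2 \<le> (x \<bullet> x) * ((A *\<^sub>v x) \<bullet> (A *\<^sub>v x))"
      using vec_Cauchy_Schwarz[of x n "A *\<^sub>v x"] A x by simp
    also have "\<dots> \<le> (x \<bullet> x) * (K * (x \<bullet> x))"
      by (intro mult_left_mono K x scalar_prod_self_nonneg)
    also have "\<dots> = (sqrt K * (x \<bullet> x))\<^sup>2" using K(1) by (simp add: power2_eq_square)
    finally show ?thesis
      using K(1) scalar_prod_self_nonneg[of x] by (simp add: abs_le_square_iff[symmetric] abs_mult)
  qed
  with K(1) show ?thesis by (intro exI[of _ "sqrt K"]) auto
qed

text \<open>This avoids compactness. With \<open>y = H x\<close>, Cauchy-Schwarz for the form of
  \<open>H\<close> bounds the squared norm of \<open>y\<close> by \<open>L\<close> times the form at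
  \<open>x\<close>. The inverse \<open>B\<close> recovers \<open>x\<close> from \<open>y\<close> and
  costs a factor \<open>K\<close>, whence the constant \<open>1 / (K * L)\<close>.\<close>

lemma psd_nonsingular_coercive:
  fixes H :: "real mat"
  assumes H: "H \<in> carrier_mat n n" and sym: "H\<^sup>T = H"
    and psd: "\<And>x. x \<in> carrier_vec n \<Longrightarrow> 0 \<le> x \<bullet> (H *\<^sub>v x)"
    and det: "det H \<noteq> 0"
  shows "\<exists>d>0. \<forall>x\<in>carrier_vec n. d * (x \<bullet> x) \<le> x \<bullet> (H *\<^sub>v x)"
proof -
  obtain B where B: "B \<in> carrier_mat n n" "B * H = 1\<^sub>m n"
    using det_non_zero_imp_unit[OF H det, of "()"]
    unfolding Units_def ring_mat_def by auto
  obtain K where K: "K > 0" "\<And>x. x \<in> carrier_vec n \<Longrightarrow> (B *\<^sub>v x) \<bullet> (B *\<^sub>v x) \<le> K * (x \<bullet> x)"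
    using mult_mat_vec_bounded[OF B(1)] by blast
  obtain L where L: "L > 0" "\<And>x. x \<in> carrier_vec n \<Longrightarrow> \<bar>x \<bullet> (H *\<^sub>v x)\<bar> \<le> L * (x \<bullet> x)"
    using quadratic_form_bounded[OF H] by blast
  have "1 / (K * L) * (x \<bullet> x) \<le> x \<bullet> (H *\<^sub>v x)" if x: "x \<in> carrier_vec n" for x
  proof -
    define y where "y = H *\<^sub>v x"
    have y: "y \<in> carrier_vec n" using H x by (simp add: y_def)
    have "B *\<^sub>v y = x" unfolding y_def using H B x by (simp flip: assoc_mult_mat_vec)
    then have xy: "x \<bullet> x \<le> K * (y \<bullet> y)" using K(2)[OF y] by simp
    have "(y \<bullet> y)\<^sup>2 = (x \<bullet> (H *\<^sub>v y))\<^sup>2"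
      using transpose_mult_vec_scalar[OF H x y] sym by (simp add: y_def)
    also have "\<dots> \<le> (x \<bullet> (H *\<^sub>v x)) * (y \<bullet> (H *\<^sub>v y))"
      by (rule psd_Cauchy_Schwarz[OF H sym psd x y])
    also have "\<dots> \<le> (x \<bullet> (H *\<^sub>v x)) * (L * (y \<bullet> y))"
      using L(2)[OF y] psd[OF x] by (intro mult_left_mono) auto
    finally have le: "(y \<bullet> y) * (y \<bullet> y) \<le> (L * (x \<bullet> (H *\<^sub>v x))) * (y \<bullet> y)"
      by (simp add: power2_eq_square mult_ac)
    have "y \<bullet> y \<le> L * (x \<bullet> (H *\<^sub>v x))"
    proof (cases "y \<bullet> y = 0")
      case True
      then show ?thesis using L(1) psd[OF x] by simp
    next
      case False
      then have "0 < y \<bullet> y" using scalar_prod_self_nonneg[of y] by simp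
      with le show ?thesis by simp
    qed
    with xy K(1) have "x \<bullet> x \<le> K * (L * (x \<bullet> (H *\<^sub>v x)))"
      by (meson mult_left_mono order.trans less_imp_le)
    then show ?thesis using K(1) L(1) by (simp add: field_simps)
  qed
  with K(1) L(1) show ?thesis by (intro exI[of _ "1 / (K * L)"]) auto
qed

text \<open>
  The largest \<open>c\<close> for which \<open>G - c\<close> is positive semidefinite is an eigenvalue: otherwise
  \<open>G - c\<close> would be nonsingular, hence coercive, and \<open>c\<close> could be increased.
\<close>

lemma symmetric_min_eigenvalue:
  fixes G :: "real mat"
  assumes G: "G \<in> carrier_mat n n" and sym: "G\<^sup>T = G" and n: "0 < n"
  obtains c where "eigenvalue G c" "\<And>x. x \<in> carrier_vec n \<Longrightarrow> c * (x \<bullet> x) \<le> x \<bullet> (G *\<^sub>v x)"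
proof -
  define L where "L = {c. \<forall>x\<in>carrier_vec n. c * (x \<bullet> x) \<le> x \<bullet> (G *\<^sub>v x)}"
  obtain K where K: "K > 0" "\<And>x. x \<in> carrier_vec n \<Longrightarrow> \<bar>x \<bullet> (G *\<^sub>v x)\<bar> \<le> K * (x \<bullet> x)"
    using quadratic_form_bounded[OF G] by blast
  have "- K \<in> L" unfolding L_def using K(2) by (fastforce simp: abs_le_iff)
  then have ne: "L \<noteq> {}" by auto
  have upper: "c \<le> (x \<bullet> (G *\<^sub>v x)) / (x \<bullet> x)"
    if "c \<in> L" "x \<in> carrier_vec n" "x \<noteq> 0\<^sub>v n" for c x
    using that scalar_prod_self_pos[OF that(2,3)] by (auto simp: L_def field_simps)
  \<comment> \<open>The Rayleigh quotient at the first unit vector, which exists as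
    \<open>0 < n\<close>, bounds \<open>L\<close> from above.\<close>
  have "unit_vec n 0 \<noteq> (0\<^sub>v n :: real vec)"
    using n by (metis index_unit_vec(1) index_zero_vec(1) zero_neq_one)
  then have bdd: "bdd_above L"
    using upper[of _ "unit_vec n 0"] by (intro bdd_aboveI) auto
  define c where "c = Sup L"
  have c: "c * (x \<bullet> x) \<le> x \<bullet> (G *\<^sub>v x)" if x: "x \<in> carrier_vec n" for x
  proof (cases "x = 0\<^sub>v n")
    case True
    then show ?thesis using G by simp
  next
    case False
    have "c \<le> (x \<bullet> (G *\<^sub>v x)) / (x \<bullet> x)"
      unfolding c_def using ne upper[OF _ x False] by (intro cSup_least) auto
    then show ?thesis using scalar_prod_self_pos[OF x False] by (simp add: field_simps)
  qed
  define H where "H = char_matrix G c"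
  have H: "H \<in> carrier_mat n n" using G by (simp add: H_def)
  have form: "x \<bullet> (H *\<^sub>v x) = x \<bullet> (G *\<^sub>v x) - c * (x \<bullet> x)" if x: "x \<in> carrier_vec n" for x
  proof -
    have "H *\<^sub>v x = G *\<^sub>v x + (- c) \<cdot>\<^sub>v x"
      unfolding H_def char_matrix_def using G x
      by (intro eq_vecI) (auto simp: add_scalar_prod_distrib[of _ n])
    then show ?thesis using G x by (simp add: scalar_prod_add_distrib[of _ n])
  qed
  have Gij: "G $$ (j, i) = G $$ (i, j)" if "i < n" "j < n" for i j
    using arg_cong[OF sym, of "\<lambda>M. M $$ (i, j)"] G that by simp
  have Hsym: "H\<^sup>T = H"
    unfolding H_def char_matrix_def using G by (intro eq_matI) (auto simp: Gij)
  have "det H = 0"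
  proof (rule ccontr)
    assume "det H \<noteq> 0"
    then obtain d where d: "d > 0" "\<And>x. x \<in> carrier_vec n \<Longrightarrow> d * (x \<bullet> x) \<le> x \<bullet> (H *\<^sub>v x)"
      using psd_nonsingular_coercive[OF H Hsym] form c by fastforce
    have "c + d \<in> L"
      unfolding L_def using d(2) form by (auto simp: algebra_simps)
    then have "c + d \<le> c" unfolding c_def using bdd by (intro cSup_upper)
    with d(1) show False by simp
  qed
  then have "eigenvalue G c" using eigenvalue_det[OF G] by (simp add: H_def)
  with c that show thesis by blast
qed

subsection \<open>Extreme eigenvalues and singular values\<close>

lemma finite_eigenvalues:
  fixes G :: "real mat"
  assumes G: "G \<in> carrier_mat n n"
  shows "finite {e. eigenvalue G e}"
proof -
  have "char_poly G \<noteq> 0" using degree_monic_char_poly[OF G] by auto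
  then show ?thesis
    unfolding eigenvalue_root_char_poly[OF G] by (rule poly_roots_finite)
qed

lemma eigenvalueE:
  assumes "eigenvalue G e" "G \<in> carrier_mat n n"
  obtains v where "v \<in> carrier_vec n" "v \<noteq> 0\<^sub>v n" "G *\<^sub>v v = e \<cdot>\<^sub>v v"
  using assms unfolding eigenvalue_def eigenvector_def by auto

lemma eigenvalueI:
  assumes "G \<in> carrier_mat n n" "v \<in> carrier_vec n" "v \<noteq> 0\<^sub>v n" "G *\<^sub>v v = e \<cdot>\<^sub>v v"
  shows "eigenvalue G e"
  using assms unfolding eigenvalue_def eigenvector_def by auto

text \<open>Apply the previous result to \<open>- G\<close>: its extremal eigenvalue
  \<open>c\<close> gives the eigenvalue \<open>- c\<close> of \<open>G\<close>, which dominates the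
  form and is itself at most \<open>lambda_max G\<close>.\<close>

lemma quadratic_form_le_lambda_max:
  assumes G: "G \<in> carrier_mat n n" and sym: "G\<^sup>T = G" and n: "0 < n"
    and x: "x \<in> carrier_vec n"
  shows "x \<bullet> (G *\<^sub>v x) \<le> lambda_max G * (x \<bullet> x)"
proof -
  have neg: "- G *\<^sub>v v = - (G *\<^sub>v v)" if "v \<in> carrier_vec n" for v
    using G that by (intro eq_vecI) auto
  have "(- G)\<^sup>T = - G" using sym G by (metis transpose_uminus)
  then obtain c where c: "eigenvalue (- G) c"
    "\<And>x. x \<in> carrier_vec n \<Longrightarrow> c * (x \<bullet> x) \<le> x \<bullet> (- G *\<^sub>v x)"
    using symmetric_min_eigenvalue[of "- G" n] G n by auto
  obtain v where v: "v \<in> carrier_vec n" "v \<noteq> 0\<^sub>v n" "- G *\<^sub>v v = c \<cdot>\<^sub>v v"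
    using eigenvalueE[OF c(1)] G by (metis uminus_carrier_iff_mat)
  have "G *\<^sub>v v = - (- G *\<^sub>v v)" using neg[OF v(1)] by simp
  also have "\<dots> = (- c) \<cdot>\<^sub>v v" unfolding v(3) using v(1) by (intro eq_vecI) auto
  finally have "eigenvalue G (- c)" using eigenvalueI[OF G v(1,2)] by simp
  then have le: "- c \<le> lambda_max G"
    unfolding lambda_max_def using finite_eigenvalues[OF G] by (intro Max_ge) auto
  have "x \<bullet> (G *\<^sub>v x) \<le> - c * (x \<bullet> x)"
    using c(2)[OF x] G x by (simp add: neg)
  also have "\<dots> \<le> lambda_max G * (x \<bullet> x)"
    by (intro mult_right_mono le scalar_prod_self_nonneg)
  finally show ?thesis .
qed

text \<open>Positive definiteness keeps zero out of the spectrum, so the removal of zero in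
  \<open>lambda_min\<close> changes nothing and the minimum is the extremal Rayleigh quotient
  \<open>c\<close>.\<close>

lemma lambda_min_positive_definite:
  assumes G: "G \<in> carrier_mat n n" and sym: "G\<^sup>T = G" and n: "0 < n"
    and pd: "\<And>x. x \<in> carrier_vec n \<Longrightarrow> x \<noteq> 0\<^sub>v n \<Longrightarrow> 0 < x \<bullet> (G *\<^sub>v x)"
  shows "0 < lambda_min G" "eigenvalue G (lambda_min G)"
    "\<And>x. x \<in> carrier_vec n \<Longrightarrow> lambda_min G * (x \<bullet> x) \<le> x \<bullet> (G *\<^sub>v x)"
    "\<And>e. eigenvalue G e \<Longrightarrow> lambda_min G \<le> e"
proof -
  obtain c where c: "eigenvalue G c" "\<And>x. x \<in> carrier_vec n \<Longrightarrow> c * (x \<bullet> x) \<le> x \<bullet> (G *\<^sub>v x)"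
    using symmetric_min_eigenvalue[OF G sym n] by blast
  have rayleigh: "\<exists>v\<in>carrier_vec n. 0 < v \<bullet> v \<and> 0 < v \<bullet> (G *\<^sub>v v) \<and> v \<bullet> (G *\<^sub>v v) = e * (v \<bullet> v)"
    if e: "eigenvalue G e" for e
    using eigenvalueE[OF e G] pd scalar_prod_self_pos by (metis scalar_prod_smult_distrib)
  have pos: "0 < e" if "eigenvalue G e" for e
    using rayleigh[OF that] by (auto simp: zero_less_mult_iff)
  have ge: "c \<le> e" if "eigenvalue G e" for e
    using rayleigh[OF that] c(2) by fastforce
  have "{e. eigenvalue G e} - {0} = {e. eigenvalue G e}" using pos by fastforce
  then have "lambda_min G = c"
    unfolding lambda_min_def using finite_eigenvalues[OF G] c(1) ge by (intro Min_eqI) auto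
  with c ge pos show "0 < lambda_min G" "eigenvalue G (lambda_min G)"
    "\<And>x. x \<in> carrier_vec n \<Longrightarrow> lambda_min G * (x \<bullet> x) \<le> x \<bullet> (G *\<^sub>v x)"
    "\<And>e. eigenvalue G e \<Longrightarrow> lambda_min G \<le> e" by auto
qed

lemma Gram_quadratic_form:
  assumes "A \<in> carrier_mat m n" "x \<in> carrier_vec n"
  shows "x \<bullet> (A\<^sup>T * A *\<^sub>v x) = (A *\<^sub>v x) \<bullet> (A *\<^sub>v (x :: real vec))"
  using assms transpose_mult_vec_scalar[of A m n x "A *\<^sub>v x"] by simp

lemma Gram_symmetric:
  assumes "(A :: real mat) \<in> carrier_mat m n"
  shows "(A\<^sup>T * A)\<^sup>T = A\<^sup>T * A"
  using assms by (simp add: transpose_mult[of _ n m])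

lemma lambda_min_Gram:
  assumes A: "A \<in> carrier_mat m n" and n: "0 < n"
    and inj: "\<And>x. x \<in> carrier_vec n \<Longrightarrow> A *\<^sub>v x = 0\<^sub>v m \<Longrightarrow> x = 0\<^sub>v n"
  shows "0 < lambda_min (A\<^sup>T * A)" "eigenvalue (A\<^sup>T * A) (lambda_min (A\<^sup>T * A))"
    "\<And>x. x \<in> carrier_vec n \<Longrightarrow> lambda_min (A\<^sup>T * A) * (x \<bullet> x) \<le> (A *\<^sub>v x) \<bullet> (A *\<^sub>v x)"
    "\<And>e. eigenvalue (A\<^sup>T * A) e \<Longrightarrow> lambda_min (A\<^sup>T * A) \<le> e"
proof -
  have G: "A\<^sup>T * A \<in> carrier_mat n n" using A by simp
  have pd: "0 < x \<bullet> (A\<^sup>T * A *\<^sub>v x)" if "x \<in> carrier_vec n" "x \<noteq> 0\<^sub>v n" for x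
    unfolding Gram_quadratic_form[OF A that(1)]
    using A that inj by (intro scalar_prod_self_pos[of _ m]) auto
  note * = lambda_min_positive_definite[OF G Gram_symmetric[OF A] n pd]
  show "0 < lambda_min (A\<^sup>T * A)" "eigenvalue (A\<^sup>T * A) (lambda_min (A\<^sup>T * A))"
    using *(1,2) by auto
  show "lambda_min (A\<^sup>T * A) * (x \<bullet> x) \<le> (A *\<^sub>v x) \<bullet> (A *\<^sub>v x)" if "x \<in> carrier_vec n" for x
    using *(3)[OF _ _ that] Gram_quadratic_form[OF A that] by simp
  show "lambda_min (A\<^sup>T * A) \<le> e" if "eigenvalue (A\<^sup>T * A) e" for e
    using *(4)[OF _ _ that] by simp
qed

lemma lambda_max_Gram:
  assumes A: "A \<in> carrier_mat m n" and n: "0 < n" and x: "x \<in> carrier_vec n"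
  shows "(A *\<^sub>v x) \<bullet> (A *\<^sub>v x) \<le> lambda_max (A\<^sup>T * A) * (x \<bullet> x)"
  using quadratic_form_le_lambda_max[of "A\<^sup>T * A" n x] A n x
  by (simp add: Gram_symmetric Gram_quadratic_form del: assoc_mult_mat_vec)

text \<open>The matrices \<open>M\<^sup>T * M\<close> and \<open>M * M\<^sup>T\<close> have the same
  nonzero eigenvalues. When \<open>M\<^sup>T\<close> is injective the latter is positive definite,
  so \<open>min_singval M\<close> is the square root of its least eigenvalue. This turns singular
  values into norm bounds for \<open>M\<^sup>T\<close> that are attained, the only form used
  later.\<close>

lemma min_singval_full_row_rank:
  assumes M: "M \<in> carrier_mat m n" and m: "0 < m"
    and inj: "\<And>x. x \<in> carrier_vec m \<Longrightarrow> M\<^sup>T *\<^sub>v x = 0\<^sub>v n \<Longrightarrow> x = 0\<^sub>v m"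
  shows "0 < min_singval M"
    and "\<And>x. x \<in> carrier_vec m \<Longrightarrow> (min_singval M)\<^sup>2 * (x \<bullet> x) \<le> (M\<^sup>T *\<^sub>v x) \<bullet> (M\<^sup>T *\<^sub>v x)"
    and "\<exists>x\<in>carrier_vec m. x \<noteq> 0\<^sub>v m \<and> (M\<^sup>T *\<^sub>v x) \<bullet> (M\<^sup>T *\<^sub>v x) = (min_singval M)\<^sup>2 * (x \<bullet> x)"
proof -
  have MT: "M\<^sup>T \<in> carrier_mat n m" using M by simp
  define l where "l = lambda_min (M * M\<^sup>T)"
  note * = lambda_min_Gram[OF MT m inj, unfolded transpose_transpose, folded l_def]
  have G: "M * M\<^sup>T \<in> carrier_mat m m" and F: "M\<^sup>T * M \<in> carrier_mat n n" using M by auto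
  obtain u where u: "u \<in> carrier_vec m" "u \<noteq> 0\<^sub>v m" "(M * M\<^sup>T) *\<^sub>v u = l \<cdot>\<^sub>v u"
    using eigenvalueE[OF *(2) G] by auto
  have "finite (singular_values M)"
  proof (rule finite_subset)
    show "singular_values M \<subseteq> sqrt ` {e. eigenvalue (M\<^sup>T * M) e}"
      unfolding singular_values_def by (force simp: image_iff)
  qed (simp add: finite_eigenvalues[OF F])
  \<comment> \<open>\<open>M\<^sup>T\<close> maps the eigenvector \<open>u\<close> of
    \<open>M * M\<^sup>T\<close> to an eigenvector of \<open>M\<^sup>T * M\<close>.\<close>
  moreover have "sqrt l \<in> singular_values M - {0}"
  proof -
    define v where "v = M\<^sup>T *\<^sub>v u"
    have v: "v \<in> carrier_vec n" "v \<noteq> 0\<^sub>v n" using M u inj by (auto simp: v_def)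
    have "(M\<^sup>T * M) *\<^sub>v v = M\<^sup>T *\<^sub>v ((M * M\<^sup>T) *\<^sub>v u)"
      using M u(1) by (simp add: v_def)
    also have "\<dots> = l \<cdot>\<^sub>v v" unfolding u(3) v_def using M u(1) by (simp add: mult_mat_vec[of _ n m])
    finally have "eigenvalue (M\<^sup>T * M) l" by (rule eigenvalueI[OF F v])
    then show ?thesis using *(1) by (simp add: singular_values_def)
  qed
  \<comment> \<open>Conversely \<open>M\<close> maps an eigenvector for a nonzero eigenvalue back to
    one of \<open>M * M\<^sup>T\<close>, whose least eigenvalue is \<open>l\<close>.\<close>
  moreover have "sqrt l \<le> s" if "s \<in> singular_values M - {0}" for s
  proof -
    from that have s: "0 < s" "eigenvalue (M\<^sup>T * M) (s\<^sup>2)" by (auto simp: singular_values_def)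
    obtain v where v: "v \<in> carrier_vec n" "v \<noteq> 0\<^sub>v n" "(M\<^sup>T * M) *\<^sub>v v = s\<^sup>2 \<cdot>\<^sub>v v"
      using eigenvalueE[OF s(2) F] by auto
    define w where "w = M *\<^sub>v v"
    have w: "w \<in> carrier_vec m" using M v by (simp add: w_def)
    have MTw: "M\<^sup>T *\<^sub>v w = s\<^sup>2 \<cdot>\<^sub>v v" using v(3) M v(1) by (simp add: w_def)
    have "w \<noteq> 0\<^sub>v m"
    proof
      assume "w = 0\<^sub>v m"
      then have zero: "s\<^sup>2 \<cdot>\<^sub>v v = 0\<^sub>v n" using M by (subst MTw[symmetric]) auto
      have "v $ i = 0" if "i < n" for i
        using arg_cong[OF zero, of "\<lambda>x. x $ i"] that v(1) s(1) by simp
      then show False using v(1,2) by (auto intro!: eq_vecI)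
    qed
    moreover have "(M * M\<^sup>T) *\<^sub>v w = s\<^sup>2 \<cdot>\<^sub>v w"
      using M v(1) w by (simp add: MTw mult_mat_vec[of _ m n]) (simp add: w_def)
    ultimately have "eigenvalue (M * M\<^sup>T) (s\<^sup>2)" using eigenvalueI[OF G w] by simp
    then have "l \<le> s\<^sup>2" by (intro *(4))
    then show ?thesis using s(1) real_le_lsqrt by simp
  qed
  ultimately have ms: "min_singval M = sqrt l"
    unfolding min_singval_def by (intro Min_eqI) auto
  then have sq: "(min_singval M)\<^sup>2 = l" using *(1) by simp
  show "0 < min_singval M" using ms *(1) by simp
  show "(min_singval M)\<^sup>2 * (x \<bullet> x) \<le> (M\<^sup>T *\<^sub>v x) \<bullet> (M\<^sup>T *\<^sub>v x)" if "x \<in> carrier_vec m" for x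
    unfolding sq using *(3)[OF _ _ that] by simp
  have "(M\<^sup>T *\<^sub>v u) \<bullet> (M\<^sup>T *\<^sub>v u) = l * (u \<bullet> u)"
    using Gram_quadratic_form[OF MT u(1)] u(1,3) by simp
  with u sq show "\<exists>x\<in>carrier_vec m. x \<noteq> 0\<^sub>v m \<and>
      (M\<^sup>T *\<^sub>v x) \<bullet> (M\<^sup>T *\<^sub>v x) = (min_singval M)\<^sup>2 * (x \<bullet> x)" by auto
qed

text \<open>A maximal independent set of columns has \<open>n\<close> elements and hence is a basis,
  so \<open>x = M y\<close> for some \<open>y\<close>. Then
  \<open>x \<bullet> x = y \<bullet> (M\<^sup>T x)\<close> vanishes.\<close>

lemma full_rank_transpose_injective:
  assumes M: "(M :: real mat) \<in> carrier_mat n nc" and rk: "vec_space.rank n M = n"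
    and x: "x \<in> carrier_vec n" and 0: "M\<^sup>T *\<^sub>v x = 0\<^sub>v nc"
  shows "x = 0\<^sub>v n"
proof -
  interpret vec_space "TYPE(real)" n .
  have sub: "set (cols M) \<subseteq> carrier_vec n" using cols_dim[of M] M by auto
  obtain B where B: "maximal B (\<lambda>T. T \<subseteq> set (cols M) \<and> lin_indpt T)"
    using maximal_exists_superset[of "set (cols M)" "\<lambda>T. T \<subseteq> set (cols M) \<and> lin_indpt T" "{}"]
    by (auto simp: finite_lin_indpt2)
  then have Bsub: "B \<subseteq> set (cols M)" and ind: "lin_indpt B" by (auto simp: maximal_def)
  have "card B = n" using rank_card_indpt[OF M B] rk by simp
  then have "basis B"
    using dim_li_is_basis[OF fin_dim] finite_subset[OF Bsub] ind Bsub sub dim_is_n by auto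
  then have "carrier_vec n = span B" by (simp add: basis_def)
  also have "\<dots> \<subseteq> span (set (cols M))" by (rule span_is_monotone[OF Bsub])
  finally have "x \<in> col_space M" using x by (auto simp: col_space_def)
  then obtain y where y: "y \<in> carrier_vec nc" "M *\<^sub>v y = x" using col_space_eq[OF M] M by auto
  have "x \<bullet> x = y \<bullet> (M\<^sup>T *\<^sub>v x)" using transpose_mult_vec_scalar[OF M y(1) x] y(2) by simp
  then have "x \<bullet> x = 0" using 0 y(1) by simp
  then show ?thesis using scalar_prod_self_eq_0_iff[OF x] by simp
qed

subsection \<open>Kronecker products\<close>

lemma index_mult_mat_sum:
  assumes "A \<in> carrier_mat m n" "B \<in> carrier_mat n q" "i < m" "j < q"
  shows "(A * B) $$ (i, j) = (\<Sum>l<n. A $$ (i, l) * B $$ (l, j))"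
  using assms by (simp add: scalar_prod_def atLeast0LessThan)

text \<open>
  In the usual notation this is \<open>B \<otimes> A\<close>: the first argument carries the fast index, which
  matches the column order of \<^const>\<open>matricize\<close>.
\<close>

definition kronecker :: "real mat \<Rightarrow> real mat \<Rightarrow> real mat" where
  "kronecker A B = mat (dim_row A * dim_row B) (dim_col A * dim_col B)
     (\<lambda>(i, j). A $$ (i mod dim_row A, j mod dim_col A) * B $$ (i div dim_row A, j div dim_col A))"

lemma kronecker_carrier [simp]:
  "A \<in> carrier_mat p r \<Longrightarrow> B \<in> carrier_mat q s \<Longrightarrow> kronecker A B \<in> carrier_mat (p * q) (r * s)"
  by (auto simp: kronecker_def)

text \<open>The columns of \<open>matricize\<close> and the indices of \<open>kronecker\<close> are
  numbered as \<open>a + m * b\<close>; this splits sums over such numbers into double sums.\<close>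

lemma sum_mod_div:
  "(\<Sum>i<m * n. f (i mod m) (i div m)) = (\<Sum>b<n. \<Sum>a<m. f a b)" for m n :: nat
proof -
  have "(\<Sum>i<m * n. f (i mod m) (i div m)) = (\<Sum>(b, a)\<in>{..<n} \<times> {..<m}. f a b)"
  proof (rule sum.reindex_bij_witness[where i = "\<lambda>(b, a). a + m * b" and j = "\<lambda>i. (i div m, i mod m)"])
    fix ba assume "ba \<in> {..<n} \<times> {..<m}"
    then obtain a b where ba: "ba = (b, a)" "b < n" "a < m" by auto
    have "a + m * b < m * Suc b" using ba by simp
    also have "\<dots> \<le> m * n" using ba by (intro mult_le_mono2) simp
    finally show "(case ba of (b, a) \<Rightarrow> a + m * b) \<in> {..<m * n}" using ba by simp
  next
    fix i assume "i \<in> {..<m * n}"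
    then have "0 < m" "i < n * m" by (auto simp: mult.commute intro!: Nat.gr0I)
    then show "(i div m, i mod m) \<in> {..<n} \<times> {..<m}" by (auto simp: less_mult_imp_div_less)
  qed auto
  then show ?thesis by (simp add: sum.cartesian_product)
qed

lemma scalar_prod_self_mod_div:
  assumes "(v :: real vec) \<in> carrier_vec (m * n)"
    and "\<And>i. i < m * n \<Longrightarrow> v $ i = f (i mod m) (i div m)"
  shows "v \<bullet> v = (\<Sum>b<n. \<Sum>a<m. (f a b)\<^sup>2)"
proof -
  have "v \<bullet> v = (\<Sum>i<m * n. (f (i mod m) (i div m))\<^sup>2)"
    using assms by (simp add: scalar_prod_def power2_eq_square atLeast0LessThan)
  then show ?thesis using sum_mod_div[of "\<lambda>a b. (f a b)\<^sup>2" m n] by simp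
qed

text \<open>Contracting the slow index with \<open>B\<close> first leaves \<open>A\<close> acting on
  a vector that depends on \<open>i\<close> only through \<open>i div p\<close>, so norm bounds for
  \<open>A\<close> can be used slice by slice.\<close>

lemma kronecker_mult_vec_index:
  assumes A: "A \<in> carrier_mat p r" and B: "B \<in> carrier_mat q s"
    and z: "z \<in> carrier_vec (r * s)" and i: "i < p * q"
  shows "(kronecker A B *\<^sub>v z) $ i =
    (A *\<^sub>v vec r (\<lambda>a. \<Sum>b<s. B $$ (i div p, b) * z $ (a + r * b))) $ (i mod p)"
proof -
  have "0 < p" using i by (auto intro!: Nat.gr0I)
  then have p: "i mod p < p" and q: "i div p < q"
    using i by (auto simp: less_mult_imp_div_less mult.commute)
  have "(kronecker A B *\<^sub>v z) $ i = (\<Sum>j<r * s. kronecker A B $$ (i, j) * z $ j)"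
    using A B z i by (simp add: kronecker_def scalar_prod_def atLeast0LessThan)
  also have "\<dots> = (\<Sum>j<r * s. A $$ (i mod p, j mod r) * B $$ (i div p, j div r) * z $ (j mod r + r * (j div r)))"
    using A B i by (intro sum.cong) (auto simp: kronecker_def)
  also have "\<dots> = (\<Sum>b<s. \<Sum>a<r. A $$ (i mod p, a) * B $$ (i div p, b) * z $ (a + r * b))"
    by (rule sum_mod_div)
  also have "\<dots> = (\<Sum>a<r. \<Sum>b<s. A $$ (i mod p, a) * B $$ (i div p, b) * z $ (a + r * b))"
    by (rule sum.swap)
  also have "\<dots> = (A *\<^sub>v vec r (\<lambda>a. \<Sum>b<s. B $$ (i div p, b) * z $ (a + r * b))) $ (i mod p)"
    using A p by (simp add: scalar_prod_def atLeast0LessThan sum_distrib_left mult_ac)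
  finally show ?thesis .
qed

text \<open>
  \<open>kronecker A B\<close> acts by applying \<open>B\<close> to the slices of \<open>z\<close> in its slow index and then \<open>A\<close> in
  its fast index; \<open>y\<close> below is the intermediate array.
\<close>

lemma kronecker_norm_steps:
  assumes A: "A \<in> carrier_mat p r" and B: "B \<in> carrier_mat q s"
    and z: "z \<in> carrier_vec (r * s)"
  defines "y \<equiv> \<lambda>c a. \<Sum>b<s. B $$ (c, b) * z $ (a + r * b)"
  shows "(kronecker A B *\<^sub>v z) \<bullet> (kronecker A B *\<^sub>v z) =
      (\<Sum>c<q. (A *\<^sub>v vec r (y c)) \<bullet> (A *\<^sub>v vec r (y c)))" (is ?T1)
    and "(\<Sum>c<q. vec r (y c) \<bullet> vec r (y c)) =
      (\<Sum>a<r. (B *\<^sub>v vec s (\<lambda>b. z $ (a + r * b))) \<bullet> (B *\<^sub>v vec s (\<lambda>b. z $ (a + r * b))))" (is ?T2)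
    and "z \<bullet> z = (\<Sum>a<r. vec s (\<lambda>b. z $ (a + r * b)) \<bullet> vec s (\<lambda>b. z $ (a + r * b)))" (is ?T3)
proof -
  have sq: "v \<bullet> v = (\<Sum>i<n. (v $ i)\<^sup>2)" if "v \<in> carrier_vec n" for v :: "real vec" and n
    using that by (simp add: scalar_prod_def power2_eq_square atLeast0LessThan)
  have "(kronecker A B *\<^sub>v z) \<bullet> (kronecker A B *\<^sub>v z) =
      (\<Sum>c<q. \<Sum>i<p. ((A *\<^sub>v vec r (y c)) $ i)\<^sup>2)"
    unfolding y_def using kronecker_mult_vec_index[OF A B z]
    by (intro scalar_prod_self_mod_div mult_mat_vec_carrier[OF kronecker_carrier[OF A B] z])
  then show ?T1 using A by (simp add: sq[of _ p])
  have "vec r (y c) \<bullet> vec r (y c) = (\<Sum>a<r. ((B *\<^sub>v vec s (\<lambda>b. z $ (a + r * b))) $ c)\<^sup>2)"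
    if "c < q" for c
    using B that by (simp add: sq[of _ r] y_def) (simp add: scalar_prod_def atLeast0LessThan)
  then have "(\<Sum>c<q. vec r (y c) \<bullet> vec r (y c)) =
      (\<Sum>c<q. \<Sum>a<r. ((B *\<^sub>v vec s (\<lambda>b. z $ (a + r * b))) $ c)\<^sup>2)"
    by simp
  then show ?T2 using B by (subst (asm) sum.swap) (simp add: sq[of _ q])
  have "z \<bullet> z = (\<Sum>b<s. \<Sum>a<r. (z $ (a + r * b))\<^sup>2)"
    by (rule scalar_prod_self_mod_div[OF z]) simp
  then show ?T3 by (subst (asm) sum.swap) (simp add: sq[of _ s])
qed

text \<open>The bound for \<open>B\<close> is applied to every slice in the slow index, then the
  bound for \<open>A\<close> to the intermediate vectors. The sign of \<open>k\<close> matters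
  because the first estimate is multiplied by it.\<close>

lemma kronecker_norm_lower:
  assumes A: "A \<in> carrier_mat p r" and B: "B \<in> carrier_mat q s"
    and z: "z \<in> carrier_vec (r * s)" and k: "0 \<le> k"
    and Al: "\<And>x. x \<in> carrier_vec r \<Longrightarrow> k * (x \<bullet> x) \<le> (A *\<^sub>v x) \<bullet> (A *\<^sub>v x)"
    and Bl: "\<And>x. x \<in> carrier_vec s \<Longrightarrow> l * (x \<bullet> x) \<le> (B *\<^sub>v x) \<bullet> (B *\<^sub>v x)"
  shows "k * l * (z \<bullet> z) \<le> (kronecker A B *\<^sub>v z) \<bullet> (kronecker A B *\<^sub>v z)"
proof -
  let ?w = "\<lambda>a. vec s (\<lambda>b. z $ (a + r * b))"
  let ?y = "\<lambda>c. vec r (\<lambda>a. \<Sum>b<s. B $$ (c, b) * z $ (a + r * b))"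
  note st = kronecker_norm_steps[OF A B z]
  have "k * l * (z \<bullet> z) = k * (\<Sum>a<r. l * (?w a \<bullet> ?w a))"
    unfolding st(3) by (simp add: sum_distrib_left mult_ac)
  also have "\<dots> \<le> k * (\<Sum>a<r. (B *\<^sub>v ?w a) \<bullet> (B *\<^sub>v ?w a))"
    by (intro mult_left_mono k sum_mono Bl) auto
  also have "\<dots> = (\<Sum>c<q. k * (?y c \<bullet> ?y c))"
    unfolding st(2)[symmetric] by (simp add: sum_distrib_left)
  also have "\<dots> \<le> (\<Sum>c<q. (A *\<^sub>v ?y c) \<bullet> (A *\<^sub>v ?y c))"
    by (intro sum_mono Al) auto
  finally show ?thesis unfolding st(1) .
qed

lemma kronecker_norm_upper:
  assumes A: "A \<in> carrier_mat p r" and B: "B \<in> carrier_mat q s"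
    and z: "z \<in> carrier_vec (r * s)" and k: "0 \<le> k"
    and Au: "\<And>x. x \<in> carrier_vec r \<Longrightarrow> (A *\<^sub>v x) \<bullet> (A *\<^sub>v x) \<le> k * (x \<bullet> x)"
    and Bu: "\<And>x. x \<in> carrier_vec s \<Longrightarrow> (B *\<^sub>v x) \<bullet> (B *\<^sub>v x) \<le> l * (x \<bullet> x)"
  shows "(kronecker A B *\<^sub>v z) \<bullet> (kronecker A B *\<^sub>v z) \<le> k * l * (z \<bullet> z)"
proof -
  let ?w = "\<lambda>a. vec s (\<lambda>b. z $ (a + r * b))"
  let ?y = "\<lambda>c. vec r (\<lambda>a. \<Sum>b<s. B $$ (c, b) * z $ (a + r * b))"
  note st = kronecker_norm_steps[OF A B z]
  have "(\<Sum>c<q. (A *\<^sub>v ?y c) \<bullet> (A *\<^sub>v ?y c)) \<le> (\<Sum>c<q. k * (?y c \<bullet> ?y c))"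
    by (intro sum_mono Au) auto
  also have "\<dots> = k * (\<Sum>a<r. (B *\<^sub>v ?w a) \<bullet> (B *\<^sub>v ?w a))"
    unfolding st(2)[symmetric] by (simp add: sum_distrib_left)
  also have "\<dots> \<le> k * (\<Sum>a<r. l * (?w a \<bullet> ?w a))"
    by (intro mult_left_mono k sum_mono Bu) auto
  also have "\<dots> = k * l * (z \<bullet> z)"
    unfolding st(3) by (simp add: sum_distrib_left mult_ac)
  finally show ?thesis unfolding st(1) .
qed

lemma kronecker_isometry:
  assumes A: "A \<in> carrier_mat p r" and B: "B \<in> carrier_mat q s"
    and AA: "A\<^sup>T * A = 1\<^sub>m r" and BB: "B\<^sup>T * B = 1\<^sub>m s" and z: "z \<in> carrier_vec (r * s)"
  shows "(kronecker A B *\<^sub>v z) \<bullet> (kronecker A B *\<^sub>v z) = z \<bullet> z"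
proof -
  have A1: "(A *\<^sub>v x) \<bullet> (A *\<^sub>v x) = x \<bullet> x" if "x \<in> carrier_vec r" for x
    using Gram_quadratic_form[OF A that] AA that by simp
  have B1: "(B *\<^sub>v x) \<bullet> (B *\<^sub>v x) = x \<bullet> x" if "x \<in> carrier_vec s" for x
    using Gram_quadratic_form[OF B that] BB that by simp
  show ?thesis
  proof (rule antisym)
    have "(kronecker A B *\<^sub>v z) \<bullet> (kronecker A B *\<^sub>v z) \<le> 1 * 1 * (z \<bullet> z)"
      by (rule kronecker_norm_upper[OF A B z]) (use A1 B1 in auto)
    then show "(kronecker A B *\<^sub>v z) \<bullet> (kronecker A B *\<^sub>v z) \<le> z \<bullet> z" by simp
    have "1 * 1 * (z \<bullet> z) \<le> (kronecker A B *\<^sub>v z) \<bullet> (kronecker A B *\<^sub>v z)"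
      by (rule kronecker_norm_lower[OF A B z]) (use A1 B1 in auto)
    then show "z \<bullet> z \<le> (kronecker A B *\<^sub>v z) \<bullet> (kronecker A B *\<^sub>v z)" by simp
  qed
qed

subsection \<open>Leading singular vectors\<close>

lemma leading_left_singular_vectors_orthonormal:
  assumes L: "leading_left_singular_vectors M r U" and M: "M \<in> carrier_mat p N"
  shows "U \<in> carrier_mat p r" "r \<le> p" "U\<^sup>T * U = 1\<^sub>m r"
proof -
  from L M obtain W s V where rp: "r \<le> p" and svd: "is_svd M W s V"
    and U: "U = mat_of_cols p (map (col W) [0..<r])"
    unfolding leading_left_singular_vectors_def by auto
  have W: "W \<in> carrier_mat p p" "W\<^sup>T * W = 1\<^sub>m p" using svd M by (auto simp: is_svd_def Let_def)
  show Uc: "U \<in> carrier_mat p r" unfolding U by (rule carrier_matI) auto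
  show "r \<le> p" by (rule rp)
  have colU: "col U j = col W j" if "j < r" for j
    using that rp W(1) unfolding U by (subst col_mat_of_cols) auto
  show "U\<^sup>T * U = 1\<^sub>m r"
  proof (rule eq_matI)
    fix i j assume "i < dim_row (1\<^sub>m r)" "j < dim_col (1\<^sub>m r)"
    then have ij: "i < r" "j < r" by auto
    have "(U\<^sup>T * U) $$ (i, j) = (W\<^sup>T * W) $$ (i, j)"
      using ij rp Uc W(1) colU by simp
    then show "(U\<^sup>T * U) $$ (i, j) = 1\<^sub>m r $$ (i, j)" using W(2) ij rp by simp
  qed (use Uc in auto)
qed

text \<open>From \<open>M * V = W * D\<close>, column \<open>j\<close> of \<open>W\<close> times
  \<open>s j\<close> equals \<open>P\<close> applied to column \<open>j\<close> of
  \<open>R * V\<close>. Dividing by \<open>s j\<close> exhibits \<open>B\<close>; what has to be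
  shown is that the first \<open>r\<close> singular values are positive.\<close>

lemma singular_vectors_in_column_space:
  assumes L: "leading_left_singular_vectors M r U"
    and M: "M = P * R" and P: "P \<in> carrier_mat p r" and R: "R \<in> carrier_mat r N" and rN: "r \<le> N"
    and Pinj: "\<And>x. x \<in> carrier_vec r \<Longrightarrow> P *\<^sub>v x = 0\<^sub>v p \<Longrightarrow> x = 0\<^sub>v r"
    and Rinj: "\<And>x. x \<in> carrier_vec r \<Longrightarrow> R\<^sup>T *\<^sub>v x = 0\<^sub>v N \<Longrightarrow> x = 0\<^sub>v r"
  shows "\<exists>B\<in>carrier_mat r r. U = P * B"
proof -
  have Mc: "M \<in> carrier_mat p N" using M P R by simp
  from L Mc obtain W s V where rp: "r \<le> p" and svd: "is_svd M W s V"
    and U: "U = mat_of_cols p (map (col W) [0..<r])"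
    unfolding leading_left_singular_vectors_def by auto
  define D where "D = mat p N (\<lambda>(i, j). if i = j then s i else 0)"
  have D: "D \<in> carrier_mat p N" by (simp add: D_def)
  have W: "W \<in> carrier_mat p p" "W\<^sup>T * W = 1\<^sub>m p" and V: "V \<in> carrier_mat N N" "V\<^sup>T * V = 1\<^sub>m N"
    and s0: "\<And>i. i < min p N \<Longrightarrow> 0 \<le> s i"
    and mono: "\<And>i j. i \<le> j \<Longrightarrow> j < min p N \<Longrightarrow> s j \<le> s i"
    and MD: "M = W * D * V\<^sup>T"
    using svd Mc by (auto simp: is_svd_def Let_def D_def)
  have WW: "W * W\<^sup>T = 1\<^sub>m p" using mat_mult_left_right_inverse[of "W\<^sup>T" p W] W by simp
  define Q where "Q = W\<^sup>T * P"
  have Q: "Q \<in> carrier_mat p r" using W(1) P by (simp add: Q_def)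
  have WD: "W * D \<in> carrier_mat p N" and VT: "V\<^sup>T \<in> carrier_mat N N"
    and WT: "W\<^sup>T \<in> carrier_mat p p" and DV: "D * V\<^sup>T \<in> carrier_mat p N"
    using W(1) D V(1) by auto
  have "M * V = W * D * (V\<^sup>T * V)" unfolding MD by (rule assoc_mult_mat[OF WD VT V(1)])
  then have MV: "M * V = W * D" unfolding V(2) using right_mult_one_mat[OF WD] by simp
  have "Q * R = W\<^sup>T * M" unfolding M Q_def by (rule assoc_mult_mat[OF WT P R])
  also have "M = W * (D * V\<^sup>T)" unfolding MD by (rule assoc_mult_mat[OF W(1) D VT])
  also have "W\<^sup>T * (W * (D * V\<^sup>T)) = (W\<^sup>T * W) * (D * V\<^sup>T)"
    by (rule assoc_mult_mat[OF WT W(1) DV, symmetric])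
  also have "\<dots> = D * V\<^sup>T" unfolding W(2) by (rule left_mult_one_mat[OF DV])
  finally have WM: "Q * R = D * V\<^sup>T" .
  \<comment> \<open>If \<open>s j\<close> were zero, all later singular values would be too, so the
    rows of \<open>Q * R = D * V\<^sup>T\<close> from \<open>j\<close> on would vanish. Injectivity
    of \<open>R\<^sup>T\<close> passes this to the rows of \<open>Q\<close>, leaving at most
    \<open>j < r\<close> nonzero rows, against the injectivity of \<open>P\<close>.\<close>
  have pos: "0 < s j" if j: "j < r" for j
  proof (rule ccontr)
    assume "\<not> 0 < s j"
    then have sj: "s i = 0" if "j \<le> i" "i < min p N" for i
      using mono[of j i] s0[of i] that j rp rN by fastforce
    have zero: "row Q i = 0\<^sub>v r" if i: "j \<le> i" "i < p" for i
    proof (rule Rinj)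
      have "row D i = 0\<^sub>v N" using i sj by (intro eq_vecI) (auto simp: D_def)
      then have "row (D * V\<^sup>T) i = 0\<^sub>v N"
        using D V(1) i by (intro eq_vecI) auto
      moreover have "R\<^sup>T *\<^sub>v row Q i = row (Q * R) i"
        using Q R i by (intro eq_vecI) (auto intro!: comm_scalar_prod[of _ r])
      ultimately show "R\<^sup>T *\<^sub>v row Q i = 0\<^sub>v N" unfolding WM by simp
      show "row Q i \<in> carrier_vec r" using Q by (metis carrier_matD(2) row_carrier)
    qed
    \<comment> \<open>The top square block of \<open>Q\<close> has a zero row, hence a kernel
      vector; the remaining rows of \<open>Q\<close> vanish, so the same vector lies in the kernel
      of \<open>Q\<close>.\<close>
    define Z where "Z = mat r r (\<lambda>(i, l). Q $$ (i, l))"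
    have Z: "Z \<in> carrier_mat r r" by (simp add: Z_def)
    have rowZ: "row Z i = row Q i" if "i < r" for i
      using that rp Q by (intro eq_vecI) (auto simp: Z_def)
    have "Z $$ (j, i) = 0" if "i < r" for i
      using arg_cong[OF zero[of j], of "\<lambda>v. v $ i"] that j rp Q by (simp add: Z_def)
    then have "Z\<^sup>T *\<^sub>v unit_vec r j = 0\<^sub>v r"
      using j Z by (intro eq_vecI) auto
    moreover have "unit_vec r j \<noteq> (0\<^sub>v r :: real vec)"
      using j by (metis index_unit_vec(1) index_zero_vec(1) zero_neq_one)
    ultimately have "det (Z\<^sup>T) = 0"
      using det_0_iff_vec_prod_zero[of "Z\<^sup>T" r] transpose_carrier_mat[THEN iffD2, OF Z] unit_vec_carrier[of r j] by blast
    then have "det Z = 0" using det_transpose[OF Z] by simp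
    then obtain v where v: "v \<in> carrier_vec r" "v \<noteq> 0\<^sub>v r" "Z *\<^sub>v v = 0\<^sub>v r"
      using det_0_iff_vec_prod_zero[OF Z] by auto
    have "Q *\<^sub>v v = 0\<^sub>v p"
    proof (rule eq_vecI)
      fix i assume "i < dim_vec (0\<^sub>v p :: real vec)"
      then have i: "i < p" by simp
      show "(Q *\<^sub>v v) $ i = 0\<^sub>v p $ i"
      proof (cases "i < r")
        case True
        then show ?thesis using arg_cong[OF v(3), of "\<lambda>x. x $ i"] rowZ[OF True] Z Q i by simp
      next
        case False
        then show ?thesis using zero[of i] j i Q v(1) by simp
      qed
    qed (use Q in auto)
    then have "W *\<^sub>v (Q *\<^sub>v v) = 0\<^sub>v p" using W(1) by (auto intro!: eq_vecI)
    moreover have "W *\<^sub>v (Q *\<^sub>v v) = (W * W\<^sup>T) *\<^sub>v (P *\<^sub>v v)"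
      using W(1) P v(1) by (simp add: Q_def)
    ultimately have "P *\<^sub>v v = 0\<^sub>v p" using WW P v(1) by simp
    with Pinj v show False by simp
  qed
  define B where "B = mat r r (\<lambda>(i, j). (R * V) $$ (i, j) / s j)"
  have RV: "R * V \<in> carrier_mat r N" using R V by simp
  have B: "B \<in> carrier_mat r r" by (simp add: B_def)
  have "U = P * B"
  proof (rule eq_matI)
    fix i j assume "i < dim_row (P * B)" "j < dim_col (P * B)"
    then have ij: "i < p" "j < r" using P B by auto
    have jN: "j < N" "j < p" using ij rN rp by auto
    have "(P * B) $$ (i, j) = (\<Sum>l<r. P $$ (i, l) * ((R * V) $$ (l, j) / s j))"
      unfolding index_mult_mat_sum[OF P B ij] using ij by (simp add: B_def)
    also have "\<dots> = (P * (R * V)) $$ (i, j) / s j"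
      by (simp add: index_mult_mat_sum[OF P RV ij(1) jN(1)] sum_divide_distrib)
    also have "P * (R * V) = W * D" using MV M P R V(1) by simp
    also have "(W * D) $$ (i, j) = (\<Sum>l<p. W $$ (i, l) * (if l = j then s l else 0))"
      unfolding index_mult_mat_sum[OF W(1) D ij(1) jN(1)] using jN by (simp add: D_def)
    also have "\<dots> = W $$ (i, j) * s j" using jN by (simp add: if_distrib[of "\<lambda>x. _ * x"] cong: if_cong)
    finally have "(P * B) $$ (i, j) = W $$ (i, j)" using pos[OF ij(2)] by simp
    also have "\<dots> = U $$ (i, j)" using ij jN W(1) by (simp add: U mat_of_cols_index)
    finally show "U $$ (i, j) = (P * B) $$ (i, j)" by simp
  qed (use U P B in auto)
  with B show ?thesis by blast
qed

subsection \<open>Orthonormal bases of the form \<open>P * B\<close>\<close>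

lemma isometry_scalar_prod:
  assumes "U \<in> carrier_mat p r" "U\<^sup>T * U = 1\<^sub>m r" "x \<in> carrier_vec r"
  shows "(U *\<^sub>v x) \<bullet> (U *\<^sub>v x) = x \<bullet> (x :: real vec)"
  using Gram_quadratic_form[of U p r x] assms by simp

text \<open>With \<open>G = P\<^sup>T * P\<close>, orthonormality says that \<open>B\<^sup>T\<close>
  is a left inverse of the square matrix \<open>G * B\<close>; it is therefore also a right
  inverse.\<close>

lemma orthonormal_factor_inverse:
  fixes P B :: "real mat"
  assumes P: "P \<in> carrier_mat p r" and B: "B \<in> carrier_mat r r"
    and orth: "(P * B)\<^sup>T * (P * B) = 1\<^sub>m r"
  shows "(P\<^sup>T * P) * (B * B\<^sup>T) = 1\<^sub>m r"
proof -
  define G where "G = P\<^sup>T * P"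
  have PT: "P\<^sup>T \<in> carrier_mat r p" and BT: "B\<^sup>T \<in> carrier_mat r r" and G: "G \<in> carrier_mat r r"
    and PB: "P * B \<in> carrier_mat p r" and GB: "G * B \<in> carrier_mat r r"
    using P B by (auto simp: G_def)
  have "(P * B)\<^sup>T * (P * B) = (B\<^sup>T * P\<^sup>T) * (P * B)" by (simp only: transpose_mult[OF P B])
  also have "\<dots> = B\<^sup>T * (P\<^sup>T * (P * B))" by (rule assoc_mult_mat[OF BT PT PB])
  also have "P\<^sup>T * (P * B) = G * B" unfolding G_def by (rule assoc_mult_mat[OF PT P B, symmetric])
  finally have "B\<^sup>T * (G * B) = 1\<^sub>m r" using orth by simp
  then have "(G * B) * B\<^sup>T = 1\<^sub>m r" by (rule mat_mult_left_right_inverse[OF BT GB])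
  then show ?thesis using assoc_mult_mat[OF G B BT] by (simp only: G_def)
qed

lemma mat_inverse_eqI:
  fixes A B :: "'a :: field mat"
  assumes A: "A \<in> carrier_mat n n" and B: "B \<in> carrier_mat n n" and AB: "A * B = 1\<^sub>m n"
  shows "mat_inverse A = Some B"
proof (cases "mat_inverse A")
  case None
  have "det A * det B = 1" using det_mult[OF A B] AB by simp
  then have "det A \<noteq> 0" by auto
  then show ?thesis
    using det_non_zero_imp_unit[OF A, of "()"] mat_inverse(1)[OF A None, of "()"] by blast
next
  case (Some X)
  then have X: "X * A = 1\<^sub>m n" "X \<in> carrier_mat n n" using mat_inverse(2)[OF A Some] by auto
  have "X = X * (A * B)" using X(2) AB by simp
  also have "\<dots> = (X * A) * B" by (rule assoc_mult_mat[OF X(2) A B, symmetric])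
  also have "\<dots> = B" using X(1) B by simp
  finally show ?thesis using Some by simp
qed

lemma le_of_square_le_mult:
  fixes a b :: real
  assumes "a\<^sup>2 \<le> a * b" "0 \<le> a" "0 \<le> b"
  shows "a \<le> b"
  using assms by (cases "a = 0") (auto simp: power2_eq_square)

text \<open>\<open>P * B\<close> is an isometry and \<open>P\<close> expands squared norms by at
  least \<open>l\<close>, so \<open>B\<close> contracts them by \<open>1 / l\<close>. Cauchy-Schwarz
  transfers this to \<open>B\<^sup>T\<close>, which produces the rows of \<open>P * B\<close> from
  those of \<open>P\<close>.\<close>

lemma orthonormal_factor_transpose_bound:
  fixes P B :: "real mat"
  assumes P: "P \<in> carrier_mat p r" and B: "B \<in> carrier_mat r r"
    and orth: "(P * B)\<^sup>T * (P * B) = 1\<^sub>m r" and l: "0 < l"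
    and low: "\<And>x. x \<in> carrier_vec r \<Longrightarrow> l * (x \<bullet> x) \<le> (P *\<^sub>v x) \<bullet> (P *\<^sub>v x)"
    and x: "x \<in> carrier_vec r"
  shows "(B\<^sup>T *\<^sub>v x) \<bullet> (B\<^sup>T *\<^sub>v x) \<le> (x \<bullet> x) / l"
proof (rule le_of_square_le_mult)
  define w where "w = B\<^sup>T *\<^sub>v x"
  define u where "u = B *\<^sub>v w"
  have w: "w \<in> carrier_vec r" and u: "u \<in> carrier_vec r" using B x by (auto simp: w_def u_def)
  have "w \<bullet> w = ((P * B) *\<^sub>v w) \<bullet> ((P * B) *\<^sub>v w)"
    using isometry_scalar_prod[OF mult_carrier_mat[OF P B] orth w] by simp
  also have "(P * B) *\<^sub>v w = P *\<^sub>v u" using P B w by (simp add: u_def)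
  finally have "l * (u \<bullet> u) \<le> w \<bullet> w" using low[OF u] by simp
  then have uu: "u \<bullet> u \<le> (w \<bullet> w) / l" using l by (simp add: field_simps)
  have "w \<bullet> w = x \<bullet> u" using transpose_vec_mult_scalar[OF B w x] by (simp add: w_def u_def)
  then have "(w \<bullet> w)\<^sup>2 \<le> (x \<bullet> x) * (u \<bullet> u)" using vec_Cauchy_Schwarz[OF x u] by simp
  also have "\<dots> \<le> (x \<bullet> x) * ((w \<bullet> w) / l)" by (intro mult_left_mono uu scalar_prod_self_nonneg)
  finally show "((B\<^sup>T *\<^sub>v x) \<bullet> (B\<^sup>T *\<^sub>v x))\<^sup>2 \<le> ((B\<^sup>T *\<^sub>v x) \<bullet> (B\<^sup>T *\<^sub>v x)) * ((x \<bullet> x) / l)"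
    by (simp add: w_def mult_ac)
qed (use l in \<open>auto simp: scalar_prod_self_nonneg\<close>)

text \<open>In general \<open>P\<^sup>T\<close> has a kernel, but not on the column space of
  \<open>P\<close>. With \<open>u = B x\<close>, the squared norm of \<open>x\<close> is
  \<open>u \<bullet> y\<close>, and the squared norm of \<open>u\<close> is at most that of
  \<open>x\<close> divided by \<open>l\<close>.\<close>

lemma orthonormal_factor_adjoint_lower:
  fixes P B :: "real mat"
  assumes P: "P \<in> carrier_mat p r" and B: "B \<in> carrier_mat r r"
    and orth: "(P * B)\<^sup>T * (P * B) = 1\<^sub>m r" and l: "0 < l"
    and low: "\<And>x. x \<in> carrier_vec r \<Longrightarrow> l * (x \<bullet> x) \<le> (P *\<^sub>v x) \<bullet> (P *\<^sub>v x)"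
    and x: "x \<in> carrier_vec r"
  defines "y \<equiv> P\<^sup>T *\<^sub>v ((P * B) *\<^sub>v x)"
  shows "l * (x \<bullet> x) \<le> y \<bullet> y"
proof -
  define u where "u = B *\<^sub>v x"
  have u: "u \<in> carrier_vec r" using B x by (simp add: u_def)
  have Pu: "(P * B) *\<^sub>v x = P *\<^sub>v u" using P B x by (simp add: u_def)
  have y: "y \<in> carrier_vec r" using P u unfolding y_def Pu by simp
  have xx: "x \<bullet> x = (P *\<^sub>v u) \<bullet> (P *\<^sub>v u)"
    using isometry_scalar_prod[OF mult_carrier_mat[OF P B] orth x] Pu by simp
  then have "x \<bullet> x = u \<bullet> y"
    using transpose_mult_vec_scalar[OF P u] P u by (simp add: y_def Pu)
  then have "(x \<bullet> x)\<^sup>2 \<le> (u \<bullet> u) * (y \<bullet> y)" using vec_Cauchy_Schwarz[OF u y] by simp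
  also have "\<dots> \<le> ((x \<bullet> x) / l) * (y \<bullet> y)"
    using low[OF u] l xx by (intro mult_right_mono scalar_prod_self_nonneg) (simp add: field_simps)
  finally have "(x \<bullet> x)\<^sup>2 \<le> (x \<bullet> x) * ((y \<bullet> y) / l)" by simp
  then have "x \<bullet> x \<le> (y \<bullet> y) / l"
    by (rule le_of_square_le_mult) (use l in \<open>auto simp: scalar_prod_self_nonneg\<close>)
  then show ?thesis using l by (simp add: field_simps)
qed

lemma transpose_mult_vec_upper:
  fixes P :: "real mat"
  assumes P: "P \<in> carrier_mat p r" and h: "0 \<le> h"
    and up: "\<And>x. x \<in> carrier_vec r \<Longrightarrow> (P *\<^sub>v x) \<bullet> (P *\<^sub>v x) \<le> h * (x \<bullet> x)"
    and w: "w \<in> carrier_vec p"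
  shows "(P\<^sup>T *\<^sub>v w) \<bullet> (P\<^sup>T *\<^sub>v w) \<le> h * (w \<bullet> w)"
proof (rule le_of_square_le_mult)
  define y where "y = P\<^sup>T *\<^sub>v w"
  have y: "y \<in> carrier_vec r" and Py: "P *\<^sub>v y \<in> carrier_vec p" using P w by (auto simp: y_def)
  have "y \<bullet> y = w \<bullet> (P *\<^sub>v y)" using transpose_vec_mult_scalar[OF P y w] by (simp add: y_def)
  then have "(y \<bullet> y)\<^sup>2 \<le> (w \<bullet> w) * ((P *\<^sub>v y) \<bullet> (P *\<^sub>v y))"
    using vec_Cauchy_Schwarz[OF w Py] by simp
  also have "\<dots> \<le> (w \<bullet> w) * (h * (y \<bullet> y))" by (intro mult_left_mono up y scalar_prod_self_nonneg)
  finally show "((P\<^sup>T *\<^sub>v w) \<bullet> (P\<^sup>T *\<^sub>v w))\<^sup>2 \<le> ((P\<^sup>T *\<^sub>v w) \<bullet> (P\<^sup>T *\<^sub>v w)) * (h * (w \<bullet> w))"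
    by (simp add: y_def mult_ac)
qed (use h in \<open>auto simp: scalar_prod_self_nonneg\<close>)

text \<open>Here \<open>P * (S * K\<^sup>T)\<close> and \<open>U * (C * L\<^sup>T)\<close> are the
  two factorizations of one matricization of the data tensor. Applying their transposes to
  \<open>U x\<close> gives \<open>L C\<^sup>T x = K S\<^sup>T y\<close> with
  \<open>y = P\<^sup>T U x\<close>, so the norms of \<open>C\<^sup>T x\<close> and
  \<open>S\<^sup>T y\<close> can be compared through the bounds on \<open>P\<close> and
  \<open>K\<close>.\<close>

lemma core_min_singval_bounds:
  fixes P B U S C K L :: "real mat"
  assumes P: "P \<in> carrier_mat p r" and B: "B \<in> carrier_mat r r" and r: "0 < r"
    and U: "U = P * B" and orth: "U\<^sup>T * U = 1\<^sub>m r"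
    and S: "S \<in> carrier_mat r n" and C: "C \<in> carrier_mat r n"
    and K: "K \<in> carrier_mat N n" and L: "L \<in> carrier_mat N n"
    and eq: "P * (S * K\<^sup>T) = U * (C * L\<^sup>T)"
    and l: "0 < l" and h: "0 \<le> h" and k: "0 < k" and m: "0 \<le> m"
    and Plow: "\<And>x. x \<in> carrier_vec r \<Longrightarrow> l * (x \<bullet> x) \<le> (P *\<^sub>v x) \<bullet> (P *\<^sub>v x)"
    and Pup: "\<And>x. x \<in> carrier_vec r \<Longrightarrow> (P *\<^sub>v x) \<bullet> (P *\<^sub>v x) \<le> h * (x \<bullet> x)"
    and Klow: "\<And>z. z \<in> carrier_vec n \<Longrightarrow> k * (z \<bullet> z) \<le> (K *\<^sub>v z) \<bullet> (K *\<^sub>v z)"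
    and Kup: "\<And>z. z \<in> carrier_vec n \<Longrightarrow> (K *\<^sub>v z) \<bullet> (K *\<^sub>v z) \<le> m * (z \<bullet> z)"
    and Liso: "\<And>z. z \<in> carrier_vec n \<Longrightarrow> (L *\<^sub>v z) \<bullet> (L *\<^sub>v z) = z \<bullet> z"
    and Sinj: "\<And>x. x \<in> carrier_vec r \<Longrightarrow> S\<^sup>T *\<^sub>v x = 0\<^sub>v n \<Longrightarrow> x = 0\<^sub>v r"
  shows "l * k * (min_singval S)\<^sup>2 \<le> (min_singval C)\<^sup>2"
    and "(min_singval C)\<^sup>2 \<le> h * m * (min_singval S)\<^sup>2"
    and "0 < min_singval C" "0 < min_singval S"
proof -
  note Sv = min_singval_full_row_rank[OF S r Sinj]
  have Uc: "U \<in> carrier_mat p r" using U P B by simp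
  define y where "y = (\<lambda>x. P\<^sup>T *\<^sub>v (U *\<^sub>v x))"
  have y: "y x \<in> carrier_vec r" if "x \<in> carrier_vec r" for x
    using that Uc P by (simp add: y_def)
  have CS: "(C\<^sup>T *\<^sub>v x) \<bullet> (C\<^sup>T *\<^sub>v x) = (K *\<^sub>v (S\<^sup>T *\<^sub>v y x)) \<bullet> (K *\<^sub>v (S\<^sup>T *\<^sub>v y x))"
    if x: "x \<in> carrier_vec r" for x
  proof -
    have Ux: "U *\<^sub>v x \<in> carrier_vec p" using Uc x by simp
    have tr: "(A * (D * E\<^sup>T))\<^sup>T *\<^sub>v w = E *\<^sub>v (D\<^sup>T *\<^sub>v (A\<^sup>T *\<^sub>v w))"
      if A: "A \<in> carrier_mat p r" and D: "D \<in> carrier_mat r n" and E: "E \<in> carrier_mat N n"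
        and w: "w \<in> carrier_vec p" for A D E :: "real mat" and w
      using A D E w
      by (simp add: transpose_mult[of A p r "D * E\<^sup>T" N] transpose_mult[of D r n "E\<^sup>T" N]
          assoc_mult_mat_vec[of E N n "D\<^sup>T * A\<^sup>T" p w] assoc_mult_mat_vec[of "D\<^sup>T" n r "A\<^sup>T" p w])
    have "(U * (C * L\<^sup>T))\<^sup>T *\<^sub>v (U *\<^sub>v x) = L *\<^sub>v (C\<^sup>T *\<^sub>v (U\<^sup>T *\<^sub>v (U *\<^sub>v x)))"
      by (rule tr[OF Uc C L Ux])
    also have "U\<^sup>T *\<^sub>v (U *\<^sub>v x) = (U\<^sup>T * U) *\<^sub>v x" using Uc x by simp
    also have "\<dots> = x" unfolding orth using x by simp
    finally have "L *\<^sub>v (C\<^sup>T *\<^sub>v x) = K *\<^sub>v (S\<^sup>T *\<^sub>v y x)"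
      using tr[OF P S K Ux] eq by (simp add: y_def)
    then show ?thesis using Liso[of "C\<^sup>T *\<^sub>v x"] C x by simp
  qed
  have low: "l * k * (min_singval S)\<^sup>2 * (x \<bullet> x) \<le> (C\<^sup>T *\<^sub>v x) \<bullet> (C\<^sup>T *\<^sub>v x)"
    if x: "x \<in> carrier_vec r" for x
  proof -
    have "l * k * (min_singval S)\<^sup>2 * (x \<bullet> x) = k * ((min_singval S)\<^sup>2 * (l * (x \<bullet> x)))"
      by simp
    also have "\<dots> \<le> k * ((min_singval S)\<^sup>2 * (y x \<bullet> y x))"
      using orthonormal_factor_adjoint_lower[OF P B orth[unfolded U] l Plow x] k
      by (intro mult_left_mono) (auto simp: y_def U)
    also have "\<dots> \<le> k * ((S\<^sup>T *\<^sub>v y x) \<bullet> (S\<^sup>T *\<^sub>v y x))"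
      using k by (intro mult_left_mono Sv(2) y x) auto
    also have "\<dots> \<le> (C\<^sup>T *\<^sub>v x) \<bullet> (C\<^sup>T *\<^sub>v x)"
      unfolding CS[OF x] using S y[OF x] by (intro Klow) auto
    finally show ?thesis .
  qed
  \<comment> \<open>Full row rank of \<open>C\<close> is not assumed; it follows from the lower
    bound and allows \<open>min_singval C\<close> to be read as a Rayleigh quotient.\<close>
  have "x = 0\<^sub>v r" if x: "x \<in> carrier_vec r" and "C\<^sup>T *\<^sub>v x = 0\<^sub>v n" for x
  proof -
    have "l * k * (min_singval S)\<^sup>2 * (x \<bullet> x) \<le> 0" using low[OF x] that(2) by simp
    moreover have "0 < l * k * (min_singval S)\<^sup>2" using l k Sv(1) by simp
    ultimately have "x \<bullet> x \<le> 0" by (meson mult_pos_pos not_le)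
    then show ?thesis
      using scalar_prod_self_nonneg[of x] scalar_prod_self_eq_0_iff[OF x] by simp
  qed
  note Cv = min_singval_full_row_rank[OF C r this]
  show "0 < min_singval C" "0 < min_singval S" using Cv(1) Sv(1) by auto
  obtain x where x: "x \<in> carrier_vec r" "x \<noteq> 0\<^sub>v r"
    "(C\<^sup>T *\<^sub>v x) \<bullet> (C\<^sup>T *\<^sub>v x) = (min_singval C)\<^sup>2 * (x \<bullet> x)" using Cv(3) by blast
  show "l * k * (min_singval S)\<^sup>2 \<le> (min_singval C)\<^sup>2"
    using low[OF x(1)] x(3) scalar_prod_self_pos[OF x(1,2)] by simp
  \<comment> \<open>For the upper bound one test vector is enough: the one whose image under
    \<open>y\<close> attains the minimum for \<open>S\<close>.\<close>
  obtain v where v: "v \<in> carrier_vec r" "v \<noteq> 0\<^sub>v r"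
    "(S\<^sup>T *\<^sub>v v) \<bullet> (S\<^sup>T *\<^sub>v v) = (min_singval S)\<^sup>2 * (v \<bullet> v)" using Sv(3) by blast
  \<comment> \<open>\<open>u\<close> is the preimage of \<open>v\<close> under \<open>y\<close>\<close>
  define u where "u = B\<^sup>T *\<^sub>v v"
  have u: "u \<in> carrier_vec r" using B v by (simp add: u_def)
  have Bu: "B *\<^sub>v u = (B * B\<^sup>T) *\<^sub>v v" using B v(1) by (simp add: u_def)
  have "y u = P\<^sup>T *\<^sub>v (P *\<^sub>v (B *\<^sub>v u))"
    unfolding y_def U using P B u by (simp add: assoc_mult_mat_vec[of P p r B r u])
  also have "\<dots> = (P\<^sup>T * P) *\<^sub>v (B *\<^sub>v u)"
    using P B u by (simp add: assoc_mult_mat_vec[of "P\<^sup>T" r p P r])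
  also have "\<dots> = ((P\<^sup>T * P) * (B * B\<^sup>T)) *\<^sub>v v"
    unfolding Bu using P B v(1) assoc_mult_mat_vec[of "P\<^sup>T * P" r r "B * B\<^sup>T" r v] by simp
  finally have yu: "y u = v"
    unfolding orthonormal_factor_inverse[OF P B orth[unfolded U]] using v(1) by simp
  have "v \<bullet> v \<le> h * ((U *\<^sub>v u) \<bullet> (U *\<^sub>v u))"
    using transpose_mult_vec_upper[OF P h Pup, of "U *\<^sub>v u"] Uc u yu by (simp add: y_def)
  then have vu: "v \<bullet> v \<le> h * (u \<bullet> u)" using isometry_scalar_prod[OF Uc orth u] by simp
  have "u \<noteq> 0\<^sub>v r" using vu scalar_prod_self_pos[OF v(1,2)] by auto
  then have uu: "0 < u \<bullet> u" by (rule scalar_prod_self_pos[OF u])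
  have "(min_singval C)\<^sup>2 * (u \<bullet> u) \<le> (C\<^sup>T *\<^sub>v u) \<bullet> (C\<^sup>T *\<^sub>v u)" using Cv(2) u by blast
  also have "\<dots> \<le> m * ((S\<^sup>T *\<^sub>v v) \<bullet> (S\<^sup>T *\<^sub>v v))"
    unfolding CS[OF u] yu using S v(1) by (intro Kup) auto
  also have "\<dots> = m * (min_singval S)\<^sup>2 * (v \<bullet> v)" using v(3) by simp
  also have "\<dots> \<le> m * (min_singval S)\<^sup>2 * (h * (u \<bullet> u))"
    using vu m by (intro mult_left_mono) auto
  finally have "(min_singval C)\<^sup>2 * (u \<bullet> u) \<le> (h * m * (min_singval S)\<^sup>2) * (u \<bullet> u)"
    by (simp add: mult_ac)
  with uu show "(min_singval C)\<^sup>2 \<le> h * m * (min_singval S)\<^sup>2" by simp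
qed

subsection \<open>Matricizations of multilinear products\<close>

lemma modes_distinct: "k \<noteq> k + 1" "k \<noteq> k + 2" "k + 1 \<noteq> k + 2" for k :: 3
proof -
  have "(1 :: 3) \<noteq> 0" "(2 :: 3) \<noteq> 0" "(1 :: 3) \<noteq> 2" by simp_all
  then show "k \<noteq> k + 1" "k \<noteq> k + 2" "k + 1 \<noteq> k + 2" by auto
qed

lemma UNIV_modes: "UNIV = {k, k + 1, k + 2}" for k :: 3
proof -
  have "card {k, k + 1, k + 2} = card (UNIV :: 3 set)" using modes_distinct[of k] by simp
  then show ?thesis by (metis card_subset_eq finite subset_UNIV)
qed

lemma prod_modes: "(\<Prod>j\<in>UNIV. f j) = f k * (f (k + 1) * f (k + 2))" for k :: 3
  unfolding UNIV_modes[of k] using modes_distinct[of k] by simp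

lemma prod_other_modes: "(\<Prod>j\<in>UNIV - {k}. f j) = f (k + 1) * f (k + 2)" for k :: 3
proof -
  have "UNIV - {k} = {k + 1, k + 2}" using UNIV_modes[of k] modes_distinct[of k] by auto
  then show ?thesis using modes_distinct[of k] by simp
qed

lemma mode_prod_commute:
  assumes "k \<noteq> l"
  shows "mode_prod k (mode_prod l X A) B = mode_prod l (mode_prod k X B) A"
proof
  fix i
  have "mode_prod k (mode_prod l X A) B i =
      (\<Sum>a<dim_col B. \<Sum>b<dim_col A. B $$ (i k, a) * (A $$ (i l, b) * X (i(k := a, l := b))))"
    using assms by (simp add: mode_prod_def sum_distrib_left)
  also have "\<dots> = (\<Sum>b<dim_col A. \<Sum>a<dim_col B. A $$ (i l, b) * (B $$ (i k, a) * X (i(l := b, k := a))))"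
    using assms by (subst sum.swap) (simp add: fun_upd_twist mult_ac)
  also have "\<dots> = mode_prod l (mode_prod k X B) A i"
    using assms by (simp add: mode_prod_def sum_distrib_left)
  finally show "mode_prod k (mode_prod l X A) B i = mode_prod l (mode_prod k X B) A i" .
qed

text \<open>Products along different modes commute, so any mode can be made outermost, with the
  other two in the cyclic order used by \<open>matricize\<close>.\<close>

lemma multilinear_prod_cyclic:
  "multilinear_prod X A =
    mode_prod k (mode_prod (k + 1) (mode_prod (k + 2) X (A (k + 2))) (A (k + 1))) (A k)"
proof -
  have ne: "(1 :: 3) \<noteq> 2" "(2 :: 3) \<noteq> 0" "(1 :: 3) \<noteq> 0" by simp_all
  have eqs: "(1 + 2 :: 3) = 0" "(2 + 2 :: 3) = 1" "(2 + 1 :: 3) = 0" "(3 :: 3) = 0" "(4 :: 3) = 1" by simp_all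
  have "k = 1 \<or> k = 2 \<or> k = 0" using UNIV_modes[of 0] by auto
  then show ?thesis
  proof (elim disjE)
    assume "k = 1"
    then show ?thesis unfolding multilinear_prod_def
      using mode_prod_commute[OF ne(1)] mode_prod_commute[OF ne(2)] mode_prod_commute[OF ne(3)]
      by (simp add: eqs)
  next
    assume "k = 2"
    then show ?thesis unfolding multilinear_prod_def
      using mode_prod_commute[OF ne(2)] by (simp add: eqs)
  next
    assume "k = 0"
    then show ?thesis unfolding multilinear_prod_def
      using mode_prod_commute[OF ne(1)] by (simp add: eqs)
  qed
qed

lemma multilinear_prod_entry:
  "multilinear_prod X A i = (\<Sum>j<dim_col (A k). A k $$ (i k, j) *
    (\<Sum>l<dim_col (A (k + 1)). A (k + 1) $$ (i (k + 1), l) *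
    (\<Sum>m<dim_col (A (k + 2)). A (k + 2) $$ (i (k + 2), m) *
      X ((\<lambda>_. 0)(k := j, k + 1 := l, k + 2 := m)))))"
proof -
  \<comment> \<open>The three updates overwrite every mode, so the base index may be replaced by the
    zero function of \<open>matricize\<close>.\<close>
  have upd: "i(k := j, k + 1 := l, k + 2 := m) = (\<lambda>_. 0)(k := j, k + 1 := l, k + 2 := m)" for j l m
    using UNIV_modes[of k] by (auto simp: fun_eq_iff)
  have "(i(k := j)) (k + 1) = i (k + 1)" "(i(k := j, k + 1 := l)) (k + 2) = i (k + 2)" for j l
    using modes_distinct[of k] by auto
  then show ?thesis
    unfolding multilinear_prod_cyclic[of X A k] mode_prod_def by (simp only: upd)
qed

lemma matricize_carrier [simp]: "matricize d k X \<in> carrier_mat (d k) (d (k + 1) * d (k + 2))"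
  by (simp add: matricize_def)

text \<open>The classical unfolding identity for Tucker products. It reduces the tensor question to
  matrix factorizations, one for each mode.\<close>

lemma matricize_multilinear_prod:
  assumes A: "\<And>k. A k \<in> carrier_mat (p k) (r k)"
  shows "matricize p k (multilinear_prod X A) =
    A k * (matricize r k X * (kronecker (A (k + 1)) (A (k + 2)))\<^sup>T)" (is "?L = A k * (?S * ?K\<^sup>T)")
proof (rule eq_matI)
  have K: "?K \<in> carrier_mat (p (k + 1) * p (k + 2)) (r (k + 1) * r (k + 2))"
    by (rule kronecker_carrier[OF A A])
  have S: "?S \<in> carrier_mat (r k) (r (k + 1) * r (k + 2))" by simp
  have KT: "?K\<^sup>T \<in> carrier_mat (r (k + 1) * r (k + 2)) (p (k + 1) * p (k + 2))" using K by simp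
  have SK: "?S * ?K\<^sup>T \<in> carrier_mat (r k) (p (k + 1) * p (k + 2))" by (rule mult_carrier_mat[OF S KT])
  show "dim_row ?L = dim_row (A k * (?S * ?K\<^sup>T))" "dim_col ?L = dim_col (A k * (?S * ?K\<^sup>T))"
    using A[of k] K by (auto simp: matricize_def)
  fix a b assume "a < dim_row (A k * (?S * ?K\<^sup>T))" "b < dim_col (A k * (?S * ?K\<^sup>T))"
  then have a: "a < p k" and b: "b < p (k + 1) * p (k + 2)" using A[of k] K by auto
  let ?b1 = "b mod p (k + 1)" and ?b2 = "b div p (k + 1)"
  let ?X = "\<lambda>j l m. X ((\<lambda>_. 0)(k := j, k + 1 := l, k + 2 := m))"
  note ne = modes_distinct[of k]
  have "?L $$ (a, b) = multilinear_prod X A ((\<lambda>_. 0)(k := a, k + 1 := ?b1, k + 2 := ?b2))"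
    using a b by (simp add: matricize_def)
  also have "\<dots> = (\<Sum>j<r k. A k $$ (a, j) * (\<Sum>l<r (k + 1). A (k + 1) $$ (?b1, l) *
      (\<Sum>m<r (k + 2). A (k + 2) $$ (?b2, m) * ?X j l m)))"
    unfolding multilinear_prod_entry[of X A _ k] using ne A[THEN carrier_matD(2)] by simp
  also have "\<dots> = (\<Sum>j<r k. A k $$ (a, j) * (?S * ?K\<^sup>T) $$ (j, b))"
  proof (intro sum.cong refl arg_cong2[where f = "(*)"])
    fix j assume "j \<in> {..<r k}"
    then have j: "j < r k" by simp
    have "(?S * ?K\<^sup>T) $$ (j, b) = (\<Sum>c<r (k + 1) * r (k + 2). ?S $$ (j, c) * ?K\<^sup>T $$ (c, b))"
      by (rule index_mult_mat_sum[OF S KT j b])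
    also have "\<dots> = (\<Sum>c<r (k + 1) * r (k + 2). ?X j (c mod r (k + 1)) (c div r (k + 1)) *
        (A (k + 1) $$ (?b1, c mod r (k + 1)) * A (k + 2) $$ (?b2, c div r (k + 1))))"
      using j b A[of "k + 1"] A[of "k + 2"]
      by (intro sum.cong) (auto simp: matricize_def kronecker_def)
    also have "\<dots> = (\<Sum>m<r (k + 2). \<Sum>l<r (k + 1). ?X j l m *
        (A (k + 1) $$ (?b1, l) * A (k + 2) $$ (?b2, m)))"
      by (rule sum_mod_div)
    also have "\<dots> = (\<Sum>l<r (k + 1). \<Sum>m<r (k + 2). ?X j l m *
        (A (k + 1) $$ (?b1, l) * A (k + 2) $$ (?b2, m)))"
      by (rule sum.swap)
    finally show "(\<Sum>l<r (k + 1). A (k + 1) $$ (?b1, l) *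
        (\<Sum>m<r (k + 2). A (k + 2) $$ (?b2, m) * ?X j l m)) = (?S * ?K\<^sup>T) $$ (j, b)"
      by (simp add: sum_distrib_left mult_ac)
  qed
  also have "\<dots> = (A k * (?S * ?K\<^sup>T)) $$ (a, b)"
    by (rule index_mult_mat_sum[OF A SK a b, symmetric])
  finally show "?L $$ (a, b) = (A k * (?S * ?K\<^sup>T)) $$ (a, b)" .
qed

lemma matricize_cong:
  assumes "tensor_eq p X Y"
  shows "matricize p k X = matricize p k Y"
  unfolding matricize_def
proof (intro cong_mat refl, clarify)
  fix a b assume a: "a < p k" and b: "b < p (k + 1) * p (k + 2)"
  let ?i = "(\<lambda>_. 0)(k := a, k + 1 := b mod p (k + 1), k + 2 := b div p (k + 1))"
  have "0 < p (k + 1)" using b by (auto intro!: Nat.gr0I)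
  then have m: "b mod p (k + 1) < p (k + 1)" and d: "b div p (k + 1) < p (k + 2)"
    using b by (auto simp: less_mult_imp_div_less mult.commute)
  have "?i j < p j" for j
    using UNIV_modes[of k] a m d modes_distinct[of k] by auto
  then have "?i \<in> index_set p" by (simp add: index_set_def del: fun_upd_apply)
  then show "X ?i = Y ?i" using assms by (auto simp: tensor_eq_def)
qed

section \<open>Membership matrices, pure nodes and the incoherence parameter\<close>

lemma pure_nodes_injective:
  assumes P: "(P :: real mat) \<in> carrier_mat p r"
    and pure: "\<And>l. l < r \<Longrightarrow> \<exists>i<p. pure_node P l i"
    and x: "x \<in> carrier_vec r" and 0: "P *\<^sub>v x = 0\<^sub>v p"
  shows "x = 0\<^sub>v r"
proof (rule eq_vecI)
  fix l assume "l < dim_vec (0\<^sub>v r :: real vec)"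
  then have l: "l < r" by simp
  obtain i where i: "i < p" "row P i = unit_vec r l" using pure[OF l] P by (auto simp: pure_node_def)
  have "(P *\<^sub>v x) $ i = x $ l" using i P x l by simp
  then show "x $ l = 0\<^sub>v r $ l" using 0 i l by simp
qed (use x in simp)

text \<open>Entries in the unit interval dominate their squares, and each row sums to one.\<close>

lemma membership_row_norm:
  assumes P: "membership_matrix p r P" and i: "i < p"
  shows "row P i \<bullet> row P i \<le> 1"
proof -
  have Pc: "P \<in> carrier_mat p r" using P by (simp add: membership_matrix_def)
  have "row P i \<bullet> row P i = (\<Sum>l<r. P $$ (i, l) * P $$ (i, l))"
    using Pc i by (simp add: scalar_prod_def atLeast0LessThan)
  also have "\<dots> \<le> (\<Sum>l<r. P $$ (i, l))"
    using P i by (intro sum_mono) (auto simp: membership_matrix_def mult_left_le)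
  also have "\<dots> = 1" using P i by (simp add: membership_matrix_def)
  finally show ?thesis .
qed

text \<open>A row of \<open>P\<close> at a pure node is a unit vector and selects a row of
  \<open>B\<close>. In particular the result does not depend on which pure nodes are chosen.\<close>

lemma U_pure_eq:
  assumes P: "P \<in> carrier_mat p r" and B: "B \<in> carrier_mat r r" and n: "pure_choice P n"
  shows "U_pure (P * B) n = B"
proof (rule eq_matI)
  fix l j assume "l < dim_row B" "j < dim_col B"
  then have lj: "l < r" "j < r" using B by auto
  then have nl: "n l < p" "row P (n l) = unit_vec r l"
    using n P by (auto simp: pure_choice_def pure_node_def)
  have "U_pure (P * B) n $$ (l, j) = (P * B) $$ (n l, j)" using B lj by (simp add: U_pure_def)
  also have "\<dots> = unit_vec r l \<bullet> col B j" using nl P B lj by simp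
  also have "\<dots> = B $$ (l, j)" using B lj by simp
  finally show "U_pure (P * B) n $$ (l, j) = B $$ (l, j)" .
qed (use B in \<open>auto simp: U_pure_def\<close>)

lemma incoherence_eq:
  "incoherence p r U = (MAX k. sqrt (real (p k) / real (r k)) * two_inf_norm (U k))"
  unfolding incoherence_def by (rule Least_equality) auto

lemma two_inf_norm_le:
  assumes "U \<in> carrier_mat p r" "0 < p" "\<And>i. i < p \<Longrightarrow> row U i \<bullet> row U i \<le> c"
  shows "two_inf_norm U \<le> sqrt c"
  using assms unfolding two_inf_norm_def euclid_norm_def by (subst Max_le_iff) auto

subsection \<open>Tensor mixed-membership blockmodels\<close>

text \<open>One instance of the model with the regularity constants as parameters: bounds proved
  here whose constants involve only \<open>c_low\<close> and \<open>c_up\<close> are uniform over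
  all instances.\<close>

locale mixed_membership_tucker =
  fixes c_low c_up :: real and p r :: dims and S T C :: tensor and P U :: "3 \<Rightarrow> real mat"
  assumes c_low: "0 < c_low" and c_up: "0 < c_up"
    and r_pos: "\<And>k. 0 < r k"
    and memb: "\<And>k. membership_matrix (p k) (r k) (P k)"
    and model: "tensor_eq p T (multilinear_prod S P)"
    and tucker: "tucker_decomposition p r T C U"
    and r_le: "\<And>k. r k \<le> (\<Prod>j\<in>UNIV - {k}. r j)"
    and low: "\<And>k. real (p k) / real (r k) \<le> c_low * lambda_min ((P k)\<^sup>T * P k)"
    and up: "\<And>k. lambda_max ((P k)\<^sup>T * P k) \<le> c_up * (real (p k) / real (r k))"
    and rank: "\<And>k. vec_space.rank (r k) (matricize r k S) = r k"
    and pure: "\<And>k l. l < r k \<Longrightarrow> \<exists>i<p k. pure_node (P k) l i"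
begin

definition ratio :: "3 \<Rightarrow> real" where "ratio k = real (p k) / real (r k)"

lemma P_carrier: "P k \<in> carrier_mat (p k) (r k)"
  using memb by (simp add: membership_matrix_def)

lemma P_inj: "x \<in> carrier_vec (r k) \<Longrightarrow> P k *\<^sub>v x = 0\<^sub>v (p k) \<Longrightarrow> x = 0\<^sub>v (r k)"
  using pure_nodes_injective[OF P_carrier pure] by blast

lemma leading: "leading_left_singular_vectors (matricize p k T) (r k) (U k)"
  using tucker by (simp add: tucker_decomposition_def)

lemma U_carrier: "U k \<in> carrier_mat (p k) (r k)"
  and r_le_p: "r k \<le> p k"
  and U_orth: "(U k)\<^sup>T * U k = 1\<^sub>m (r k)"
  using leading_left_singular_vectors_orthonormal[OF leading matricize_carrier] by auto

lemma p_pos: "0 < p k"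
  using r_pos[of k] r_le_p[of k] by simp

lemma ratio_pos: "0 < ratio k"
  using r_pos p_pos by (simp add: ratio_def)

lemma P_lower:
  assumes "x \<in> carrier_vec (r k)"
  shows "ratio k / c_low * (x \<bullet> x) \<le> (P k *\<^sub>v x) \<bullet> (P k *\<^sub>v x)"
proof -
  have "ratio k / c_low \<le> lambda_min ((P k)\<^sup>T * P k)"
    using low[of k] c_low by (subst pos_divide_le_eq) (simp_all add: ratio_def mult.commute)
  then have "ratio k / c_low * (x \<bullet> x) \<le> lambda_min ((P k)\<^sup>T * P k) * (x \<bullet> x)"
    by (intro mult_right_mono scalar_prod_self_nonneg)
  also have "\<dots> \<le> (P k *\<^sub>v x) \<bullet> (P k *\<^sub>v x)"
    using lambda_min_Gram(3)[OF P_carrier r_pos P_inj assms] by blast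
  finally show ?thesis .
qed

lemma P_upper:
  assumes "x \<in> carrier_vec (r k)"
  shows "(P k *\<^sub>v x) \<bullet> (P k *\<^sub>v x) \<le> c_up * ratio k * (x \<bullet> x)"
proof -
  have "(P k *\<^sub>v x) \<bullet> (P k *\<^sub>v x) \<le> lambda_max ((P k)\<^sup>T * P k) * (x \<bullet> x)"
    by (rule lambda_max_Gram[OF P_carrier r_pos assms])
  also have "\<dots> \<le> c_up * ratio k * (x \<bullet> x)"
    using up[of k] by (intro mult_right_mono scalar_prod_self_nonneg) (simp add: ratio_def)
  finally show ?thesis .
qed

abbreviation (input) K where "K k \<equiv> kronecker (P (k + 1)) (P (k + 2))"

lemma K_carrier: "K k \<in> carrier_mat (p (k + 1) * p (k + 2)) (r (k + 1) * r (k + 2))"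
  by (rule kronecker_carrier[OF P_carrier P_carrier])

lemma K_lower:
  assumes "z \<in> carrier_vec (r (k + 1) * r (k + 2))"
  shows "ratio (k + 1) / c_low * (ratio (k + 2) / c_low) * (z \<bullet> z) \<le> (K k *\<^sub>v z) \<bullet> (K k *\<^sub>v z)"
  using kronecker_norm_lower[OF P_carrier P_carrier assms _ P_lower P_lower]
    ratio_pos[of "k + 1"] c_low by simp

lemma K_upper:
  assumes "z \<in> carrier_vec (r (k + 1) * r (k + 2))"
  shows "(K k *\<^sub>v z) \<bullet> (K k *\<^sub>v z) \<le> c_up * ratio (k + 1) * (c_up * ratio (k + 2)) * (z \<bullet> z)"
  using kronecker_norm_upper[OF P_carrier P_carrier assms _ P_upper P_upper]
    ratio_pos[of "k + 1"] c_up by simp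

lemma S_inj:
  "x \<in> carrier_vec (r k) \<Longrightarrow> (matricize r k S)\<^sup>T *\<^sub>v x = 0\<^sub>v (r (k + 1) * r (k + 2)) \<Longrightarrow> x = 0\<^sub>v (r k)"
  by (rule full_rank_transpose_injective[OF matricize_carrier rank])

lemma matricize_T_P: "matricize p k T = P k * (matricize r k S * (K k)\<^sup>T)"
  using matricize_cong[OF model] matricize_multilinear_prod[OF P_carrier] by simp

lemma matricize_T_U:
  "matricize p k T = U k * (matricize r k C * (kronecker (U (k + 1)) (U (k + 2)))\<^sup>T)"
  using matricize_cong[of p T "multilinear_prod C U"] matricize_multilinear_prod[OF U_carrier] tucker
  by (simp add: tucker_decomposition_def)

lemma K_inj:
  assumes z: "z \<in> carrier_vec (r (k + 1) * r (k + 2))"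
    and 0: "K k *\<^sub>v z = 0\<^sub>v (p (k + 1) * p (k + 2))"
  shows "z = 0\<^sub>v (r (k + 1) * r (k + 2))"
proof (rule ccontr)
  assume "z \<noteq> 0\<^sub>v (r (k + 1) * r (k + 2))"
  then have "0 < ratio (k + 1) / c_low * (ratio (k + 2) / c_low) * (z \<bullet> z)"
    using scalar_prod_self_pos[OF z] ratio_pos c_low by simp
  with K_lower[OF z] 0 show False by simp
qed

lemma U_factor: "\<exists>B\<in>carrier_mat (r k) (r k). U k = P k * B"
proof (rule singular_vectors_in_column_space[OF leading matricize_T_P P_carrier _ _ P_inj])
  let ?R = "matricize r k S * (K k)\<^sup>T" and ?N = "p (k + 1) * p (k + 2)"
  have S: "matricize r k S \<in> carrier_mat (r k) (r (k + 1) * r (k + 2))" by simp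
  have KT: "(K k)\<^sup>T \<in> carrier_mat (r (k + 1) * r (k + 2)) ?N" using K_carrier by simp
  show "?R \<in> carrier_mat (r k) ?N" by (rule mult_carrier_mat[OF S KT])
  \<comment> \<open>The matricization must have at least \<open>r k\<close> columns, so that its
    first \<open>r k\<close> singular values exist.\<close>
  have "r k \<le> r (k + 1) * r (k + 2)" using r_le[of k] by (simp add: prod_other_modes)
  also have "\<dots> \<le> ?N" by (intro mult_le_mono r_le_p)
  finally show "r k \<le> ?N" .
  show "x = 0\<^sub>v (r k)" if x: "x \<in> carrier_vec (r k)" and 0: "?R\<^sup>T *\<^sub>v x = 0\<^sub>v ?N" for x
  proof -
    have "?R\<^sup>T = K k * (matricize r k S)\<^sup>T" unfolding transpose_mult[OF S KT] by simp
    then have "K k *\<^sub>v ((matricize r k S)\<^sup>T *\<^sub>v x) = 0\<^sub>v ?N"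
      using 0 assoc_mult_mat_vec[OF K_carrier _ x, of "(matricize r k S)\<^sup>T"] by simp
    then have "(matricize r k S)\<^sup>T *\<^sub>v x = 0\<^sub>v (r (k + 1) * r (k + 2))"
      using x by (intro K_inj mult_mat_vec_carrier[of _ _ "r k"]) auto
    then show ?thesis by (rule S_inj[OF x])
  qed
qed auto

text \<open>Each of the three modes contributes its \<open>ratio\<close> and one factor
  \<open>1 / c_low\<close> or \<open>c_up\<close>: mode \<open>k\<close> through \<open>P k\<close>,
  the other two through the Kronecker product. Hence the cubes.\<close>

lemma core_bounds:
  shows "(ratio k * (ratio (k + 1) * ratio (k + 2))) / c_low ^ 3 * (min_singval (matricize r k S))\<^sup>2
      \<le> (min_singval (matricize r k C))\<^sup>2"
    and "(min_singval (matricize r k C))\<^sup>2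
      \<le> c_up ^ 3 * (ratio k * (ratio (k + 1) * ratio (k + 2))) * (min_singval (matricize r k S))\<^sup>2"
    and "0 < min_singval (matricize r k C)" "0 < min_singval (matricize r k S)"
proof -
  obtain B where B: "B \<in> carrier_mat (r k) (r k)" "U k = P k * B" using U_factor by blast
  have pos: "0 < ratio k / c_low" "0 \<le> c_up * ratio k"
    "0 < ratio (k + 1) / c_low * (ratio (k + 2) / c_low)"
    "0 \<le> c_up * ratio (k + 1) * (c_up * ratio (k + 2))"
    using ratio_pos[of k] ratio_pos[of "k + 1"] ratio_pos[of "k + 2"] c_low c_up by auto
  have eq: "P k * (matricize r k S * (K k)\<^sup>T) =
      U k * (matricize r k C * (kronecker (U (k + 1)) (U (k + 2)))\<^sup>T)"
    using matricize_T_P matricize_T_U by simp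
  note b = core_min_singval_bounds[OF P_carrier B(1) r_pos B(2) U_orth matricize_carrier
      matricize_carrier K_carrier kronecker_carrier[OF U_carrier U_carrier] eq pos]
  note prems = P_lower P_upper K_lower K_upper S_inj
    kronecker_isometry[OF U_carrier U_carrier U_orth U_orth]
  have "ratio k / c_low * (ratio (k + 1) / c_low * (ratio (k + 2) / c_low)) *
      (min_singval (matricize r k S))\<^sup>2 \<le> (min_singval (matricize r k C))\<^sup>2"
    by (rule b(1)) (fact prems | assumption)+
  then show "(ratio k * (ratio (k + 1) * ratio (k + 2))) / c_low ^ 3 * (min_singval (matricize r k S))\<^sup>2
      \<le> (min_singval (matricize r k C))\<^sup>2"
    by (simp add: power3_eq_cube mult_ac)
  have "(min_singval (matricize r k C))\<^sup>2 \<le>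
      c_up * ratio k * (c_up * ratio (k + 1) * (c_up * ratio (k + 2))) * (min_singval (matricize r k S))\<^sup>2"
    by (rule b(2)) (fact prems | assumption)+
  then show "(min_singval (matricize r k C))\<^sup>2
      \<le> c_up ^ 3 * (ratio k * (ratio (k + 1) * ratio (k + 2))) * (min_singval (matricize r k S))\<^sup>2"
    by (simp add: power3_eq_cube mult_ac)
  show "0 < min_singval (matricize r k C)"
    by (rule b(3)) (fact prems | assumption)+
  show "0 < min_singval (matricize r k S)"
    by (rule b(4)) (fact prems | assumption)+
qed

section \<open>From single matricizations to the tensor bounds\<close>

lemma prod_ratio:
  "sqrt (\<Prod>k\<in>UNIV. real (p k)) / sqrt (\<Prod>k\<in>UNIV. real (r k)) =
    sqrt (ratio k * (ratio (k + 1) * ratio (k + 2)))"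
  by (simp add: prod_modes[of _ k] ratio_def flip: real_sqrt_divide)

lemma lambda_min_tensor_le: "lambda_min_tensor d X \<le> min_singval (matricize d k X)"
  unfolding lambda_min_tensor_def by (intro Min_le) auto

lemma lambda_min_tensor_attained: "\<exists>k. lambda_min_tensor d X = min_singval (matricize d k X)"
proof -
  have "lambda_min_tensor d X \<in> range (\<lambda>k. min_singval (matricize d k X))"
    unfolding lambda_min_tensor_def by (intro Min_in) auto
  then show ?thesis by blast
qed

text \<open>The mode is chosen where the minimum for \<open>C\<close> is attained; for
  \<open>S\<close> the same mode only gives an upper estimate of \<open>lambda_min_tensor\<close>,
  which is the right direction. The scale factor does not depend on the mode by
  \<open>prod_ratio\<close>.\<close>

lemma lambda_lower:
  "sqrt (1 / c_low ^ 3) * (lambda_min_tensor r S * sqrt (\<Prod>k\<in>UNIV. real (p k)) / sqrt (\<Prod>k\<in>UNIV. real (r k)))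
    \<le> lambda_min_tensor r C"
proof -
  obtain k where k: "lambda_min_tensor r C = min_singval (matricize r k C)"
    using lambda_min_tensor_attained by blast
  let ?q = "ratio k * (ratio (k + 1) * ratio (k + 2))"
  have "sqrt (1 / c_low ^ 3) * (lambda_min_tensor r S * sqrt (\<Prod>k\<in>UNIV. real (p k)) / sqrt (\<Prod>k\<in>UNIV. real (r k)))
      = sqrt (1 / c_low ^ 3) * (sqrt ?q * lambda_min_tensor r S)"
    by (simp flip: prod_ratio[of k])
  also have "\<dots> \<le> sqrt (1 / c_low ^ 3) * (sqrt ?q * min_singval (matricize r k S))"
    using c_low ratio_pos by (intro mult_left_mono lambda_min_tensor_le) (auto simp: less_imp_le)
  also have "\<dots> = sqrt (?q / c_low ^ 3 * (min_singval (matricize r k S))\<^sup>2)"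
    using core_bounds(4)[of k] by (simp add: real_sqrt_mult real_sqrt_divide)
  also have "\<dots> \<le> sqrt ((min_singval (matricize r k C))\<^sup>2)"
    by (intro real_sqrt_le_mono core_bounds(1))
  also have "\<dots> = lambda_min_tensor r C" using core_bounds(3)[of k] k by simp
  finally show ?thesis .
qed

text \<open>Dually, the mode is chosen where the minimum for \<open>S\<close> is attained.\<close>

lemma lambda_upper:
  "lambda_min_tensor r C \<le>
    sqrt (c_up ^ 3) * (lambda_min_tensor r S * sqrt (\<Prod>k\<in>UNIV. real (p k)) / sqrt (\<Prod>k\<in>UNIV. real (r k)))"
proof -
  obtain k where k: "lambda_min_tensor r S = min_singval (matricize r k S)"
    using lambda_min_tensor_attained by blast
  let ?q = "ratio k * (ratio (k + 1) * ratio (k + 2))"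
  have "lambda_min_tensor r C \<le> min_singval (matricize r k C)" by (rule lambda_min_tensor_le)
  also have "\<dots> = sqrt ((min_singval (matricize r k C))\<^sup>2)" using core_bounds(3)[of k] by simp
  also have "\<dots> \<le> sqrt (c_up ^ 3 * ?q * (min_singval (matricize r k S))\<^sup>2)"
    by (intro real_sqrt_le_mono core_bounds(2))
  also have "\<dots> = sqrt (c_up ^ 3) * (sqrt ?q * lambda_min_tensor r S)"
    using core_bounds(4)[of k] k by (simp add: real_sqrt_mult)
  also have "\<dots> = sqrt (c_up ^ 3) * (lambda_min_tensor r S * sqrt (\<Prod>k\<in>UNIV. real (p k)) / sqrt (\<Prod>k\<in>UNIV. real (r k)))"
    by (simp flip: prod_ratio[of k])
  finally show ?thesis .
qed

text \<open>Each row of \<open>U k\<close> is \<open>B\<^sup>T\<close> applied to a row of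
  \<open>P k\<close> of norm at most one, so its squared norm is at most
  \<open>c_low / ratio k\<close>; the normalization in the incoherence parameter cancels
  \<open>ratio k\<close>.\<close>

lemma incoherence_le: "incoherence p r U \<le> sqrt c_low"
proof -
  have "sqrt (real (p k) / real (r k)) * two_inf_norm (U k) \<le> sqrt c_low" for k
  proof -
    obtain B where B: "B \<in> carrier_mat (r k) (r k)" "U k = P k * B" using U_factor by blast
    have orth: "(P k * B)\<^sup>T * (P k * B) = 1\<^sub>m (r k)" using U_orth[of k] B(2) by simp
    have l: "0 < ratio k / c_low" using ratio_pos c_low by simp
    have "row (U k) i \<bullet> row (U k) i \<le> c_low / ratio k" if i: "i < p k" for i
    proof -
      have x: "row (P k) i \<in> carrier_vec (r k)" using P_carrier by (metis carrier_matD(2) row_carrier)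
      have "row (U k) i = B\<^sup>T *\<^sub>v row (P k) i"
        unfolding B(2) using P_carrier[of k] B(1) i x
        by (intro eq_vecI) (auto intro!: comm_scalar_prod[of _ "r k"])
      then have "row (U k) i \<bullet> row (U k) i \<le> (row (P k) i \<bullet> row (P k) i) / (ratio k / c_low)"
        using orthonormal_factor_transpose_bound[OF P_carrier B(1) orth l P_lower x] by simp
      also have "\<dots> \<le> 1 / (ratio k / c_low)"
        using membership_row_norm[OF memb i] l by (intro divide_right_mono) auto
      finally show ?thesis by simp
    qed
    then have "two_inf_norm (U k) \<le> sqrt (c_low / ratio k)"
      by (rule two_inf_norm_le[OF U_carrier p_pos])
    then have "sqrt (ratio k) * two_inf_norm (U k) \<le> sqrt (ratio k) * sqrt (c_low / ratio k)"
      using ratio_pos[of k] by (intro mult_left_mono) auto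
    also have "\<dots> = sqrt c_low" using ratio_pos[of k] by (simp flip: real_sqrt_mult)
    finally show ?thesis by (simp add: ratio_def)
  qed
  then show ?thesis unfolding incoherence_eq by (subst Max_le_iff) auto
qed

lemma mat_inverse_Gram:
  assumes "pure_choice (P k) n"
  shows "mat_inverse ((P k)\<^sup>T * P k) = Some (U_pure (U k) n * (U_pure (U k) n)\<^sup>T)"
proof -
  obtain B where B: "B \<in> carrier_mat (r k) (r k)" "U k = P k * B" using U_factor by blast
  have "U_pure (U k) n = B" unfolding B(2) by (rule U_pure_eq[OF P_carrier B(1) assms])
  moreover have "(P k)\<^sup>T * P k * (B * B\<^sup>T) = 1\<^sub>m (r k)"
    using orthonormal_factor_inverse[OF P_carrier B(1)] U_orth[of k] B(2) by simp
  ultimately show ?thesis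
    using mat_inverse_eqI[of "(P k)\<^sup>T * P k" "r k" "B * B\<^sup>T"] P_carrier[of k] B(1) by simp
qed

end

theorem lemma1:
  fixes c_low c_up c_sig :: real
  assumes "c_low > 0" and "c_up > 0" and "c_sig > 0"
  shows "\<exists>a b K :: real. a > 0 \<and> b > 0 \<and> K > 0 \<and>
    (\<forall>(p :: dims) (r :: dims) (S :: tensor) (P :: 3 \<Rightarrow> real mat) (T :: tensor)
      (C :: tensor) (U :: 3 \<Rightarrow> real mat) (\<sigma> :: real).
        \<sigma> > 0 \<longrightarrow>
        (\<forall>k. r k > 0) \<longrightarrow>
        (\<forall>k. membership_matrix (p k) (r k) (P k)) \<longrightarrow>
        tensor_eq p T (multilinear_prod S P) \<longrightarrow>
        tucker_decomposition p r T C U \<longrightarrow>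
        (\<forall>k. r k \<le> (\<Prod>j\<in>UNIV - {k}. r j)) \<longrightarrow>
        (\<forall>k. real (p k) / real (r k) \<le> c_low * lambda_min ((P k)\<^sup>T * P k) \<and>
             lambda_min ((P k)\<^sup>T * P k) \<le> lambda_max ((P k)\<^sup>T * P k) \<and>
             lambda_max ((P k)\<^sup>T * P k) \<le> c_up * (real (p k) / real (r k))) \<longrightarrow>
        (\<forall>k. vec_space.rank (r k) (matricize r k S) = r k) \<longrightarrow>
        (\<forall>k. \<forall>l < r k. \<exists>i < p k. pure_node (P k) l i) \<longrightarrow>
        (condition_number r S)\<^sup>2 * (real (MAX k. p k))\<^sup>2 * ln (real (MAX k. p k))
            * (\<Prod>k\<in>UNIV. real (r k))
            / ((\<Prod>k\<in>UNIV. real (p k)) * sqrt (real (MIN k. p k)))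
          \<le> c_sig * ((lambda_min_tensor r S)\<^sup>2 / \<sigma>\<^sup>2) \<longrightarrow>
        (a * (lambda_min_tensor r S * sqrt (\<Prod>k\<in>UNIV. real (p k)) / sqrt (\<Prod>k\<in>UNIV. real (r k)))
            \<le> lambda_min_tensor r C \<and>
         lambda_min_tensor r C
            \<le> b * (lambda_min_tensor r S * sqrt (\<Prod>k\<in>UNIV. real (p k)) / sqrt (\<Prod>k\<in>UNIV. real (r k))) \<and>
         incoherence p r U \<le> K \<and>
         (\<forall>k n. pure_choice (P k) n \<longrightarrow>
            mat_inverse ((P k)\<^sup>T * P k) = Some (U_pure (U k) n * (U_pure (U k) n)\<^sup>T))))"
\<comment> \<open>The cubes come from the three modes, the square roots from bounds that were
  derived for squared singular values and squared row norms.\<close>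
proof (rule exI[of _ "sqrt (1 / c_low ^ 3)"], rule exI[of _ "sqrt (c_up ^ 3)"],
    rule exI[of _ "sqrt c_low"], intro conjI allI impI)
  show "0 < sqrt (1 / c_low ^ 3)" "0 < sqrt (c_up ^ 3)" "0 < sqrt c_low" using assms by simp_all
next
  fix p r :: dims and S T C :: tensor and P U :: "3 \<Rightarrow> real mat"
  assume "\<forall>k. r k > 0" "\<forall>k. membership_matrix (p k) (r k) (P k)"
    "tensor_eq p T (multilinear_prod S P)" "tucker_decomposition p r T C U"
    "\<forall>k. r k \<le> (\<Prod>j\<in>UNIV - {k}. r j)"
    "\<forall>k. real (p k) / real (r k) \<le> c_low * lambda_min ((P k)\<^sup>T * P k) \<and>
         lambda_min ((P k)\<^sup>T * P k) \<le> lambda_max ((P k)\<^sup>T * P k) \<and>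
         lambda_max ((P k)\<^sup>T * P k) \<le> c_up * (real (p k) / real (r k))"
    "\<forall>k. vec_space.rank (r k) (matricize r k S) = r k"
    "\<forall>k. \<forall>l < r k. \<exists>i < p k. pure_node (P k) l i"
  with assms interpret mixed_membership_tucker c_low c_up p r S T C P U
    by unfold_locales auto
  show "sqrt (1 / c_low ^ 3) * (lambda_min_tensor r S * sqrt (\<Prod>k\<in>UNIV. real (p k)) / sqrt (\<Prod>k\<in>UNIV. real (r k)))
      \<le> lambda_min_tensor r C"
    by (rule lambda_lower)
  show "lambda_min_tensor r C
      \<le> sqrt (c_up ^ 3) * (lambda_min_tensor r S * sqrt (\<Prod>k\<in>UNIV. real (p k)) / sqrt (\<Prod>k\<in>UNIV. real (r k)))"
    by (rule lambda_upper)
  show "incoherence p r U \<le> sqrt c_low" by (rule incoherence_le)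
  show "mat_inverse ((P k)\<^sup>T * P k) = Some (U_pure (U k) n * (U_pure (U k) n)\<^sup>T)"
    if "pure_choice (P k) n" for k n
    using that by (rule mat_inverse_Gram)
qed

end
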